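(* Let $T$ be a super-critical Bienaymé-Galton-Watson tree whose offspring distribution on $\mathbb{N}$ has finite mean $m>1$ and finite second moment, conditioned on non-extinction. For $n\in\mathbb{N}$ let $G_n$ be the $n$-th generation of $T$ and $T_n=\bigcup_{k=0}^nG_k$. Say that a (random) sequence $(A_n)_{n\in\mathbb{N}}$ of finite non-empty subsets of $T$, which is a function of $T$, has property $(\mathrm{P})$ if, with $U_n$ and $V_n$ being, conditionally on $T$, independent and uniformly distributed on $A_n$, both of the following hold: (a) for all $k\in\mathbb{N}$, $\lim_{n\to\infty}\mathbb{P}(d(U_n,V_n)\le k\mid T)=0$; (b) for every $\varepsilon>0$ there exists $k\in\mathbb{N}$ such that $\mathbb{P}(h(U_n\wedge V_n)>k\mid T)<\varepsilon$ for all $n$ large enough. Then: (i) Let $(\ell_n)_{n\in\mathbb{N}}$ be a (deterministic) sequence of integers with $0\le\ell_n\le n$ for all $n$, and let $A_n=\bigcup_{k=(n-\ell_n)_+}^nG_k$ be the subset composed of the last $\ell_n+1$ generations of $T_n$. Then almost surely the sequence $(A_n)_{n\in\mathbb{N}}$ has property $(\mathrm{P})$. (ii) Almost surely, both sequences $(G_n)_{n\in\mathbb{N}}$ and $(T_n)_{n\in\mathbb{N}}$ have property $(\mathrm{P})$.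
   Context: A Bienaymé-Galton-Watson tree is the random rooted genealogical tree, started from one root individual, in which individuals have independent numbers of children distributed according to the offspring distribution; conditioning on non-extinction means conditioning on the (positive probability) event that the tree is infinite. The height $h(u)$ of a vertex is its graph distance to the root, $G_n$ is the set of vertices of height $n$, $u\wedge v$ is the latest common ancestor of $u$ and $v$, $d(u,v)=h(u)+h(v)-2h(u\wedge v)$ is the graph distance, and $x_+=\max(x,0)$. For fixed $T$, the conditional probabilities are $\mathbb{P}(d(U_n,V_n)\le k\mid T)=|A_n|^{-2}\sum_{u,v\in A_n}\mathbf{1}_{\{d(u,v)\le k\}}$ and similarly for $h(U_n\wedge V_n)$. *)

theory Defs
  imports "HOL-Probability.Probability" "HOL-Library.Sublist"
begin

text \<open>
  Vertices carry Ulam--Harris labels: \<open>[]\<close> is the root and \<open>u @ [i]\<close> is the child of \<open>u\<close> with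
  index \<open>i\<close>, present when \<open>i < c u\<close>, where \<open>c u\<close> is the number of children of \<open>u\<close>.
  Hence the ancestors of \<open>u\<close> (itself included) are its prefixes.
\<close>

inductive_set ulam_harris_tree :: "(nat list \<Rightarrow> nat) \<Rightarrow> nat list set"
  for c :: "nat list \<Rightarrow> nat" where
  root: "[] \<in> ulam_harris_tree c"
| child: "u \<in> ulam_harris_tree c \<Longrightarrow> i < c u \<Longrightarrow> u @ [i] \<in> ulam_harris_tree c"

definition height :: "nat list \<Rightarrow> nat" where
  "height u = length u"

definition latest_common_ancestor :: "nat list \<Rightarrow> nat list \<Rightarrow> nat list" where
  "latest_common_ancestor u v = longest_common_prefix u v"

text \<open>The subtraction never truncates, as a common ancestor is at most as high as either vertex.\<close>

definition tree_dist :: "nat list \<Rightarrow> nat list \<Rightarrow> nat" where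
  "tree_dist u v = height u + height v - 2 * height (latest_common_ancestor u v)"

definition generation :: "nat list set \<Rightarrow> nat \<Rightarrow> nat list set" where
  "generation T n = {u \<in> T. height u = n}"

definition first_generations :: "nat list set \<Rightarrow> nat \<Rightarrow> nat list set" where
  "first_generations T n = (\<Union>k\<in>{0..n}. generation T k)"

text \<open>For natural numbers, \<open>n - l\<close> is the positive part of the difference.\<close>

definition last_generations :: "nat list set \<Rightarrow> nat \<Rightarrow> nat \<Rightarrow> nat list set" where
  "last_generations T l n = (\<Union>k\<in>{n - l..n}. generation T k)"

text \<open>The joint law, for a given tree, of two independent uniform vertices of \<open>A\<close>.\<close>

definition uniform_pair :: "nat list set \<Rightarrow> (nat list \<times> nat list) pmf" where
  "uniform_pair A = pair_pmf (pmf_of_set A) (pmf_of_set A)"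

definition property_P :: "nat list set \<Rightarrow> (nat \<Rightarrow> nat list set) \<Rightarrow> bool" where
  "property_P T A \<longleftrightarrow>
     (\<forall>n. finite (A n) \<and> A n \<noteq> {} \<and> A n \<subseteq> T) \<and>
     (\<forall>k. (\<lambda>n. measure_pmf.prob (uniform_pair (A n)) {(u, v). tree_dist u v \<le> k})
            \<longlonglongrightarrow> 0) \<and>
     (\<forall>\<epsilon>>0. \<exists>k. \<forall>\<^sub>F n in sequentially.
        measure_pmf.prob (uniform_pair (A n))
          {(u, v). height (latest_common_ancestor u v) > k} < \<epsilon>)"

text \<open>
  The numbers of children \<open>N u\<close> are attached to all labels \<open>u\<close>, including those that turn out
  not to belong to the tree.
\<close>

locale galton_watson = prob_space M
  for M :: "'w measure" +
  fixes p :: "nat pmf" and N :: "nat list \<Rightarrow> 'w \<Rightarrow> nat"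
  assumes indep_offspring: "indep_vars (\<lambda>_. count_space UNIV) N UNIV"
    and distr_offspring: "\<And>u. distr M (count_space UNIV) (N u) = measure_pmf p"

definition gw_tree :: "(nat list \<Rightarrow> 'w \<Rightarrow> nat) \<Rightarrow> 'w \<Rightarrow> nat list set" where
  "gw_tree N \<omega> = ulam_harris_tree (\<lambda>u. N u \<omega>)"

definition conditioned_on_survival ::
    "'w measure \<Rightarrow> (nat list \<Rightarrow> 'w \<Rightarrow> nat) \<Rightarrow> 'w measure" where
  "conditioned_on_survival M N =
     uniform_measure M {\<omega> \<in> space M. infinite (gw_tree N \<omega>)}"

end

theory Submission imports Defs begin

text \<open>
  All three sequences lie between \<open>G\<^sub>n\<close> and \<open>T\<^sub>n\<close>, so the number of vertices is at least \<open>Z\<^sub>n = |G\<^sub>n|\<close>,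
  while the related pairs, those whose latest common ancestor has height at least \<open>k\<close>, can be
  counted inside \<open>T\<^sub>n\<close>. Let \<open>W\<^sub>n = Z\<^sub>n / m^n\<close>. Its increments have second moments decaying like
  \<open>m^(-n)\<close>, hence \<open>W\<^sub>n\<close> converges almost surely and all \<open>(W\<^sub>n)\<^sup>2\<close> are bounded by one integrable
  variable \<open>B\<close>. Applying this bound to the subtrees rooted at height \<open>k\<close> gives at most
  \<open>K m^(2n - 2k) S\<^sub>k\<close> related pairs, where \<open>S\<^sub>k\<close> is the sum of \<open>B\<close> over these subtrees; as \<open>S\<^sub>k\<close> has mean
  \<open>m^k\<close> times that of \<open>B\<close>, the series of the \<open>m^(-2k) S\<^sub>k\<close> converges almost surely. Finally, on survival
  the limit of \<open>W\<^sub>n\<close> is positive: the probabilities of extinction and of \<open>W\<^sub>n \<longlonglongrightarrow> 0\<close> are both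
  fixed points less than 1 of the strictly convex generating function of the offspring distribution.
\<close>

section \<open>Trees and property (P)\<close>

text \<open>The offspring numbers seen from the child \<open>i\<close> of the root. They encode the
  subtree hanging there, so a recursion over the tree becomes one in which \<open>c\<close>
  varies.\<close>

definition child_offspring :: "(nat list \<Rightarrow> nat) \<Rightarrow> nat \<Rightarrow> nat list \<Rightarrow> nat" where
  "child_offspring c i = (\<lambda>u. c (i # u))"

text \<open>The inductive definition grows labels at their end, whereas the recursions below split a
  tree at its root; this equivalence links the two views.\<close>

lemma Cons_in_tree_iff:
  "i # u \<in> ulam_harris_tree c \<longleftrightarrow> i < c [] \<and> u \<in> ulam_harris_tree (child_offspring c i)"
proof
  assume "i # u \<in> ulam_harris_tree c"
  then show "i < c [] \<and> u \<in> ulam_harris_tree (child_offspring c i)"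
  proof (induction "i # u" arbitrary: u rule: ulam_harris_tree.induct)
    case (child v j)
    show ?case
    proof (cases v)
      case Nil
      with child show ?thesis by (auto intro: ulam_harris_tree.root)
    next
      case (Cons i' v')
      then have "u = v' @ [j]" "v = i # v'" using child by auto
      with child show ?thesis
        by (auto intro!: ulam_harris_tree.child simp: child_offspring_def)
    qed
  qed
next
  assume *: "i < c [] \<and> u \<in> ulam_harris_tree (child_offspring c i)"
  then have "u \<in> ulam_harris_tree (child_offspring c i)" by simp
  then show "i # u \<in> ulam_harris_tree c"
  proof induction
    case root
    with * show ?case
      using ulam_harris_tree.child[OF ulam_harris_tree.root, of i c] by simp
  next
    case (child u j)
    then show ?case
      using ulam_harris_tree.child[of "i # u" c j] by (simp add: child_offspring_def)
  qed
qed

section \<open>Sizes of the generations\<close>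

lemma generation_0: "generation (ulam_harris_tree c) 0 = {[]}"
  by (auto simp: generation_def height_def ulam_harris_tree.root)

lemma generation_Suc:
  "generation (ulam_harris_tree c) (Suc n) =
     (\<Union>i<c []. (#) i ` generation (ulam_harris_tree (child_offspring c i)) n)"
  by (auto simp: generation_def height_def length_Suc_conv Cons_in_tree_iff)

lemma finite_generation: "finite (generation (ulam_harris_tree c) n)"
  by (induction n arbitrary: c) (auto simp: generation_0 generation_Suc)

lemma card_UN_Cons_image:
  fixes S :: "nat \<Rightarrow> nat list set"
  assumes "\<And>i. i < k \<Longrightarrow> finite (S i)"
  shows "card (\<Union>i<k. (#) i ` S i) = (\<Sum>i<k. card (S i))"
proof -
  have "card (\<Union>i<k. (#) i ` S i) = (\<Sum>i<k. card ((#) i ` S i))"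
    using assms by (subst card_UN_disjoint) auto
  then show ?thesis by (simp add: card_image)
qed

definition gen_size :: "(nat list \<Rightarrow> nat) \<Rightarrow> nat \<Rightarrow> nat" where
  "gen_size c n = card (generation (ulam_harris_tree c) n)"

lemma gen_size_0 [simp]: "gen_size c 0 = 1"
  by (simp add: gen_size_def generation_0)

lemma gen_size_Suc: "gen_size c (Suc n) = (\<Sum>i<c []. gen_size (child_offspring c i) n)"
  by (simp add: gen_size_def generation_Suc card_UN_Cons_image finite_generation)

lemma first_generations_eq: "first_generations T n = {u \<in> T. length u \<le> n}"
  by (auto simp: first_generations_def generation_def height_def)

lemma finite_first_generations: "finite (first_generations (ulam_harris_tree c) n)"
  by (simp add: first_generations_def finite_generation)

lemma card_first_generations:
  "card (first_generations (ulam_harris_tree c) n) = (\<Sum>k\<le>n. gen_size c k)"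
proof -
  have "card (\<Union>k\<in>{0..n}. generation (ulam_harris_tree c) k) =
      (\<Sum>k\<in>{0..n}. card (generation (ulam_harris_tree c) k))"
    by (intro card_UN_disjoint) (auto simp: finite_generation, auto simp: generation_def)
  then show ?thesis by (simp add: first_generations_def gen_size_def atMost_atLeast0)
qed

lemma gen_size_eq_0_mono:
  assumes "gen_size c n = 0" "n \<le> n'"
  shows "gen_size c n' = 0"
proof -
  have step: "gen_size c n = 0 \<Longrightarrow> gen_size c (Suc n) = 0" for c n
    by (induction n arbitrary: c) (simp_all add: gen_size_Suc)
  show ?thesis using assms(2,1) by (induction rule: dec_induct) (simp_all add: step)
qed

text \<open>Generations are finite, so a tree that stops at some height is finite; a finite tree has
  an empty generation just above its maximal height.\<close>

lemma infinite_tree_iff: "infinite (ulam_harris_tree c) \<longleftrightarrow> (\<forall>n. gen_size c n > 0)"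
proof (intro iffI allI)
  fix n assume inf: "infinite (ulam_harris_tree c)"
  show "gen_size c n > 0"
  proof (rule ccontr)
    assume *: "\<not> gen_size c n > 0"
    have "length u < n" if u: "u \<in> ulam_harris_tree c" for u
    proof (rule ccontr)
      assume "\<not> length u < n"
      then have "gen_size c (length u) = 0" using * by (auto intro: gen_size_eq_0_mono)
      then have "generation (ulam_harris_tree c) (length u) = {}"
        by (simp add: gen_size_def finite_generation)
      then show False using u by (auto simp: generation_def height_def)
    qed
    then have "ulam_harris_tree c \<subseteq> first_generations (ulam_harris_tree c) n"
      by (auto simp: first_generations_eq intro: less_imp_le)
    with inf show False using finite_first_generations finite_subset by blast
  qed
next
  assume pos: "\<forall>n. gen_size c n > 0"
  show "infinite (ulam_harris_tree c)"
  proof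
    assume fin: "finite (ulam_harris_tree c)"
    define n where "n = Suc (Max (length ` ulam_harris_tree c))"
    have "generation (ulam_harris_tree c) n = {}"
      using Max_ge[OF finite_imageI[OF fin, of length]]
      by (fastforce simp: generation_def height_def n_def)
    with pos show False by (metis card.empty gen_size_def less_irrefl)
  qed
qed

section \<open>Pairs of vertices with a high common ancestor\<close>

definition related_pairs :: "(nat list \<Rightarrow> nat) \<Rightarrow> nat \<Rightarrow> nat \<Rightarrow> (nat list \<times> nat list) set" where
  "related_pairs c k n =
     {(u, v) \<in> first_generations (ulam_harris_tree c) n \<times> first_generations (ulam_harris_tree c) n.
        k \<le> height (latest_common_ancestor u v)}"

lemma finite_related_pairs: "finite (related_pairs c k n)"
  unfolding related_pairs_def
  by (rule finite_subset[OF _ finite_cartesian_product[OF finite_first_generations finite_first_generations]])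
    auto

lemma related_pairs_0:
  "related_pairs c 0 n =
    first_generations (ulam_harris_tree c) n \<times> first_generations (ulam_harris_tree c) n"
  by (auto simp: related_pairs_def)

lemma longest_common_prefix_length:
  "length (longest_common_prefix u v) \<le> length u" "length (longest_common_prefix u v) \<le> length v"
  by (simp_all add: prefix_length_le longest_common_prefix_prefix1 longest_common_prefix_prefix2)

lemma related_pairs_Suc_0: "related_pairs c (Suc k) 0 = {}"
  by (auto simp: related_pairs_def first_generations_eq height_def latest_common_ancestor_def)

text \<open>A common ancestor other than the root forces a common first letter \<open>i\<close>.
  Deleting it moves both vertices into the subtree of the child \<open>i\<close>, where all heights
  are lower by one.\<close>

lemma related_pairs_Suc_Suc:
  "related_pairs c (Suc k) (Suc n) =
     (\<Union>i<c []. map_prod ((#) i) ((#) i) ` related_pairs (child_offspring c i) k n)"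
proof (intro set_eqI iffI)
  fix x assume x: "x \<in> related_pairs c (Suc k) (Suc n)"
  obtain u v where uv: "x = (u, v)" by fastforce
  have "Suc k \<le> length (longest_common_prefix u v)"
    using x by (auto simp: uv related_pairs_def height_def latest_common_ancestor_def)
  then obtain i u' v' where *: "u = i # u'" "v = i # v'"
    by (cases "(u, v)" rule: longest_common_prefix.cases) (auto split: if_splits)
  have "(u', v') \<in> related_pairs (child_offspring c i) k n" "i < c []"
    using x by (auto simp: * uv related_pairs_def height_def latest_common_ancestor_def
        first_generations_eq Cons_in_tree_iff)
  then show "x \<in> (\<Union>i<c []. map_prod ((#) i) ((#) i) ` related_pairs (child_offspring c i) k n)"
    unfolding uv * by force
qed (auto simp: related_pairs_def height_def latest_common_ancestor_def
        first_generations_eq Cons_in_tree_iff)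

lemma card_related_pairs_Suc_Suc:
  "card (related_pairs c (Suc k) (Suc n)) =
     (\<Sum>i<c []. card (related_pairs (child_offspring c i) k n))"
proof -
  have "card (related_pairs c (Suc k) (Suc n)) =
      (\<Sum>i<c []. card (map_prod ((#) i) ((#) i) ` related_pairs (child_offspring c i) k n))"
    unfolding related_pairs_Suc_Suc by (intro card_UN_disjoint) (auto simp: finite_related_pairs)
  also have "\<dots> = (\<Sum>i<c []. card (related_pairs (child_offspring c i) k n))"
    by (intro sum.cong card_image inj_onI) auto
  finally show ?thesis .
qed

section \<open>Property (P) from bounds on the number of related pairs\<close>

lemma prob_uniform_pair:
  assumes "finite A" "A \<noteq> {}"
  shows "measure_pmf.prob (uniform_pair A) S = card (A \<times> A \<inter> S) / (card A)\<^sup>2"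
proof -
  have "pmf (uniform_pair A) x = pmf (pmf_of_set (A \<times> A)) x" for x
  proof (cases x)
    case (Pair u v)
    have "A \<times> A \<noteq> {}" "finite (A \<times> A)" using assms by auto
    then show ?thesis
      by (simp add: Pair uniform_pair_def pmf_pair assms card_cartesian_product indicator_def)
  qed
  \<comment> \<open>Two independent uniform vertices form a uniform element of the square, which
    turns probabilities into counts.\<close>
  then have "uniform_pair A = pmf_of_set (A \<times> A)" by (rule pmf_eqI)
  then show ?thesis
    using assms by (simp add: measure_pmf_of_set card_cartesian_product power2_eq_square)
qed

text \<open>With \<open>h\<close> the height of the latest common ancestor, the distance is the sum
  of the nonnegative numbers \<open>height u - h\<close> and \<open>height v - h\<close>, so the
  first of them is at most \<open>k\<close>.\<close>

lemma height_le_of_tree_dist_le: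
  assumes "tree_dist u v \<le> k" "height (latest_common_ancestor u v) \<le> K"
  shows "height u \<le> K + k"
  using assms longest_common_prefix_length[of u v]
  by (simp add: tree_dist_def height_def latest_common_ancestor_def)

text \<open>
  Condition (a) follows from condition (b): two vertices at distance at most \<open>k\<close> whose latest
  common ancestor has height at most \<open>K\<close> both belong to the fixed finite set of vertices of
  height at most \<open>K + k\<close>.
\<close>

lemma property_P_if_between:
  fixes a m :: real and s :: "nat \<Rightarrow> real"
  assumes inf: "infinite (ulam_harris_tree c)"
    and a: "a > 0" and m: "m > 1"
    and growth: "\<forall>\<^sub>F n in sequentially. a * m ^ n \<le> gen_size c n"
    and pairs: "\<And>k n. card (related_pairs c k n) \<le> s k * m ^ (2 * n)"
    and s: "s \<longlonglongrightarrow> 0"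
    and lower: "\<And>n. generation (ulam_harris_tree c) n \<subseteq> A n"
    and upper: "\<And>n. A n \<subseteq> first_generations (ulam_harris_tree c) n"
  shows "property_P (ulam_harris_tree c) A"
proof -
  let ?T = "ulam_harris_tree c"
  have fin: "finite (A n)" for n
    using upper finite_first_generations finite_subset by blast
  have ne: "A n \<noteq> {}" for n
  proof -
    have "gen_size c n > 0" using inf by (simp add: infinite_tree_iff)
    then show ?thesis using lower[of n] by (auto simp: gen_size_def)
  qed
  have sub: "A n \<subseteq> ?T" for n
    using upper[of n] by (auto simp: first_generations_eq)
  have cardA: "\<forall>\<^sub>F n in sequentially. a * m ^ n \<le> card (A n)"
    using growth
  proof eventually_elim
    case (elim n)
    have "gen_size c n \<le> card (A n)"
      unfolding gen_size_def by (intro card_mono fin lower)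
    with elim show ?case by linarith
  qed
  \<comment> \<open>The growth \<open>m ^ (2 * n)\<close> cancels against the squared size of
    \<open>A n\<close>, which leaves a bound that does not depend on \<open>n\<close>.\<close>
  have related: "\<forall>\<^sub>F n in sequentially. card (related_pairs c k n) / (card (A n))\<^sup>2 \<le> s k / a\<^sup>2" for k
    using cardA
  proof eventually_elim
    case (elim n)
    have pos: "a * m ^ n > 0" using a m by (intro mult_pos_pos zero_less_power) auto
    have "card (related_pairs c k n) / (card (A n))\<^sup>2 \<le> (s k * m ^ (2 * n)) / (a * m ^ n)\<^sup>2"
    proof (intro frac_le pairs)
      show "0 \<le> s k * m ^ (2 * n)" using pairs[of k n] by linarith
      show "0 < (a * m ^ n)\<^sup>2" using pos by (rule zero_less_power)
      show "(a * m ^ n)\<^sup>2 \<le> real ((card (A n))\<^sup>2)"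
        using power_mono[OF elim, of 2] pos by simp
    qed
    also have "(a * m ^ n)\<^sup>2 = a\<^sup>2 * m ^ (2 * n)"
      by (simp only: power_mult_distrib power_mult[symmetric] mult.commute[of n 2])
    also have "s k * m ^ (2 * n) / (a\<^sup>2 * m ^ (2 * n)) = s k / a\<^sup>2"
    proof -
      have "m ^ (2 * n) \<noteq> 0" using m by auto
      then show ?thesis by simp
    qed
    finally show ?case .
  qed
  have small: "\<exists>k. s k / a\<^sup>2 < \<epsilon>" if "\<epsilon> > 0" for \<epsilon>
  proof -
    have "(\<lambda>k. s k / a\<^sup>2) \<longlonglongrightarrow> 0" using tendsto_divide_zero[OF s] .
    then show ?thesis
      using order_tendstoD(2)[of _ 0 sequentially \<epsilon>] that eventually_happens'[OF sequentially_bot] by blast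
  qed
  have b: "\<exists>k. \<forall>\<^sub>F n in sequentially.
      measure_pmf.prob (uniform_pair (A n)) {(u, v). height (latest_common_ancestor u v) > k} < \<epsilon>"
    if \<epsilon>: "\<epsilon> > 0" for \<epsilon>
  proof -
    obtain k where k: "s k / a\<^sup>2 < \<epsilon>" using small[OF \<epsilon>] by blast
    have "\<forall>\<^sub>F n in sequentially.
      measure_pmf.prob (uniform_pair (A n)) {(u, v). height (latest_common_ancestor u v) > k} < \<epsilon>"
      using related[of k]
    proof eventually_elim
      case (elim n)
      have "card (A n \<times> A n \<inter> {(u, v). height (latest_common_ancestor u v) > k})
          \<le> card (related_pairs c k n)"
        using upper[of n] by (intro card_mono finite_related_pairs) (auto simp: related_pairs_def)
      then have "card (A n \<times> A n \<inter> {(u, v). height (latest_common_ancestor u v) > k}) / (card (A n))\<^sup>2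
          \<le> card (related_pairs c k n) / (card (A n))\<^sup>2"
        by (intro divide_right_mono) auto
      with elim k show ?case by (simp add: prob_uniform_pair fin ne)
    qed
    then show ?thesis by blast
  qed
  have large: "filterlim (\<lambda>n. real (card (A n))) at_top sequentially"
  proof (rule filterlim_at_top_mono[OF _ cardA])
    show "filterlim (\<lambda>n. a * m ^ n) at_top sequentially"
    proof (rule filterlim_tendsto_pos_mult_at_top[OF tendsto_const a])
      show "filterlim (\<lambda>n. m ^ n) at_top sequentially"
        using m by (intro filterlim_at_infinity_imp_filterlim_at_top
            filterlim_realpow_sequentially_gt1) auto
    qed
  qed
  have a': "(\<lambda>n. measure_pmf.prob (uniform_pair (A n)) {(u, v). tree_dist u v \<le> k}) \<longlonglongrightarrow> 0" for k
  proof (rule tendstoI)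
    fix \<epsilon> :: real assume \<epsilon>: "\<epsilon> > 0"
    \<comment> \<open>Half of \<open>\<epsilon>\<close> is for the pairs related at height
      \<open>K\<close>. The other half is for the pairs meeting the set \<open>?F\<close>, which is
      fixed while \<open>A n\<close> grows.\<close>
    obtain K where K: "s K / a\<^sup>2 < \<epsilon> / 2" using small[of "\<epsilon> / 2"] \<epsilon> by auto
    let ?F = "first_generations ?T (K + k)"
    have "(\<lambda>n. card ?F / card (A n)) \<longlonglongrightarrow> 0"
      by (rule real_tendsto_divide_at_top[OF tendsto_const large])
    then have "\<forall>\<^sub>F n in sequentially. card ?F / card (A n) < \<epsilon> / 2"
      using \<epsilon> by (intro order_tendstoD(2)) auto
    then show "\<forall>\<^sub>F n in sequentially.
        dist (measure_pmf.prob (uniform_pair (A n)) {(u, v). tree_dist u v \<le> k}) 0 < \<epsilon>"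
      using related[of K]
    proof eventually_elim
      case (elim n)
      have pos: "card (A n) > 0" using fin ne by (simp add: card_gt_0_iff)
      \<comment> \<open>If the common ancestor is lower than \<open>K\<close>, the first vertex lies
        in \<open>?F\<close>; the second one is left free, which costs only a factor
        \<open>card (A n)\<close>.\<close>
      have "A n \<times> A n \<inter> {(u, v). tree_dist u v \<le> k} \<subseteq> related_pairs c K n \<union> ?F \<times> A n"
        using upper[of n] sub[of n] height_le_of_tree_dist_le[of _ _ k K]
        by (fastforce simp: related_pairs_def first_generations_eq height_def)
      then have "card (A n \<times> A n \<inter> {(u, v). tree_dist u v \<le> k})
          \<le> card (related_pairs c K n \<union> ?F \<times> A n)"
        by (intro card_mono) (auto simp: finite_related_pairs finite_first_generations fin)
      also have "\<dots> \<le> card (related_pairs c K n) + card ?F * card (A n)"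
        using card_Un_le[of "related_pairs c K n" "?F \<times> A n"] by (simp add: card_cartesian_product)
      finally have "real (card (A n \<times> A n \<inter> {(u, v). tree_dist u v \<le> k}))
          \<le> real (card (related_pairs c K n) + card ?F * card (A n))"
        by (rule of_nat_mono)
      then have "card (A n \<times> A n \<inter> {(u, v). tree_dist u v \<le> k}) / (card (A n))\<^sup>2
          \<le> real (card (related_pairs c K n) + card ?F * card (A n)) / (card (A n))\<^sup>2"
        by (rule divide_right_mono) simp
      also have "\<dots> = card (related_pairs c K n) / (card (A n))\<^sup>2 + card ?F / card (A n)"
        using pos by (simp add: add_divide_distrib power2_eq_square)
      also have "\<dots> < \<epsilon>" using elim K by linarith
      finally show ?case by (simp add: prob_uniform_pair fin ne)
    qed
  qed
  show ?thesis
    unfolding property_P_def using fin ne sub a' b by blast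
qed

section \<open>Decomposition at the root\<close>

text \<open>The canonical space of an i.i.d. family of offspring numbers. Passing to the subtree of
  a child is a measure-preserving map of this space into itself.\<close>

definition offspring_space :: "nat pmf \<Rightarrow> (nat list \<Rightarrow> nat) measure" where
  "offspring_space p = PiM UNIV (\<lambda>_. measure_pmf p)"

lemma prob_space_offspring_space: "prob_space (offspring_space p)"
  unfolding offspring_space_def by (intro prob_space_PiM prob_space_measure_pmf)

lemma space_offspring_space [simp]: "space (offspring_space p) = UNIV"
  by (simp add: offspring_space_def space_PiM)

lemma measurable_offspring [measurable]:
  "(\<lambda>c. c u) \<in> offspring_space p \<rightarrow>\<^sub>M count_space UNIV"
proof -
  have "(\<lambda>c. c u) \<in> offspring_space p \<rightarrow>\<^sub>M measure_pmf p"
    unfolding offspring_space_def by (rule measurable_component_singleton) simp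
  then show ?thesis by (simp cong: measurable_cong_sets)
qed

lemma measurable_fun_offspring:
  "g \<in> UNIV \<rightarrow> space N \<Longrightarrow> (\<lambda>c. g (c u)) \<in> offspring_space p \<rightarrow>\<^sub>M N"
  by (rule measurable_compose[OF measurable_offspring]) simp

lemma measurable_child_offspring [measurable]:
  "(\<lambda>c. child_offspring c i) \<in> offspring_space p \<rightarrow>\<^sub>M offspring_space p"
  unfolding child_offspring_def
  by (subst (2) offspring_space_def, rule measurable_abs_UNIV) simp

lemma measurable_fun_child_offspring:
  "g \<in> offspring_space p \<rightarrow>\<^sub>M N \<Longrightarrow> (\<lambda>c. g (child_offspring c i)) \<in> offspring_space p \<rightarrow>\<^sub>M N"
  by (rule measurable_compose[OF measurable_child_offspring])

text \<open>Prepending \<open>i\<close> is injective on labels, and reindexing an i.i.d. family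
  along an injection preserves its law.\<close>

lemma distr_child_offspring:
  "distr (offspring_space p) (offspring_space p) (\<lambda>c. child_offspring c i) = offspring_space p"
  using distr_PiM_reindex[of UNIV "\<lambda>_. measure_pmf p" "(#) i" UNIV]
  by (simp add: offspring_space_def child_offspring_def prob_space_measure_pmf restrict_def)

lemma distr_offspring: "distr (offspring_space p) (count_space UNIV) (\<lambda>c. c u) = measure_pmf p"
proof -
  have "distr (PiM UNIV (\<lambda>_. measure_pmf p)) (measure_pmf p) (\<lambda>c. c u) = measure_pmf p"
    by (rule distr_PiM_component) (simp_all add: prob_space_measure_pmf)
  moreover have "distr (offspring_space p) (count_space UNIV) (\<lambda>c. c u)
      = distr (PiM UNIV (\<lambda>_. measure_pmf p)) (measure_pmf p) (\<lambda>c. c u)"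
    by (rule distr_cong) (simp_all add: offspring_space_def)
  ultimately show ?thesis by simp
qed

lemma nn_integral_child_offspring:
  assumes [measurable]: "g \<in> borel_measurable (offspring_space p)"
  shows "(\<integral>\<^sup>+c. g (child_offspring c i) \<partial>offspring_space p) = (\<integral>\<^sup>+c. g c \<partial>offspring_space p)"
  by (subst (2) distr_child_offspring[symmetric, of p i]) (simp add: nn_integral_distr)

lemma nn_integral_offspring:
  "(\<integral>\<^sup>+c. g (c u) \<partial>offspring_space p) = (\<integral>\<^sup>+k. g k \<partial>measure_pmf p)"
  by (subst distr_offspring[symmetric, of p u]) (simp add: nn_integral_distr)

lemma integrable_child_offspring:
  fixes g :: "_ \<Rightarrow> real"
  assumes "integrable (offspring_space p) g"
  shows "integrable (offspring_space p) (\<lambda>c. g (child_offspring c i))"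
  using assms by (subst (asm) distr_child_offspring[symmetric, of p i])
    (rule integrable_distr[OF measurable_child_offspring])

lemma integral_child_offspring:
  fixes g :: "_ \<Rightarrow> real"
  assumes [measurable]: "g \<in> borel_measurable (offspring_space p)"
  shows "(\<integral>c. g (child_offspring c i) \<partial>offspring_space p) = (\<integral>c. g c \<partial>offspring_space p)"
  by (subst (2) distr_child_offspring[symmetric, of p i]) (simp add: integral_distr)

lemma indep_offspring_space:
  "prob_space.indep_vars (offspring_space p) (\<lambda>_. measure_pmf p) (\<lambda>u c. c u) UNIV"
proof -
  interpret prob_space "offspring_space p" by (rule prob_space_offspring_space)
  have m: "(\<lambda>c. c u) \<in> offspring_space p \<rightarrow>\<^sub>M measure_pmf p" for u
    unfolding offspring_space_def by (rule measurable_component_singleton) simp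
  have "distr (offspring_space p) (measure_pmf p) (\<lambda>c. c u) = measure_pmf p" for u
    unfolding offspring_space_def
    by (rule distr_PiM_component) (simp_all add: prob_space_measure_pmf)
  then show ?thesis
    using m by (subst indep_vars_iff_distr_eq_PiM)
      (simp_all add: offspring_space_def restrict_def distr_id2 cong: distr_cong)
qed

text \<open>The branching property: the root and the subtrees of different children read disjoint
  blocks of labels. Index \<open>0\<close> stands for the root and \<open>Suc i\<close> for the
  child \<open>i\<close>, so that one independent family contains both.\<close>

lemma indep_root_child_offspring:
  fixes g :: "nat \<Rightarrow> 'b :: topological_space"
  assumes h: "\<And>i. h i \<in> borel_measurable (offspring_space p)"
  shows "prob_space.indep_vars (offspring_space p) (\<lambda>_. borel)
    (\<lambda>j c. case j of 0 \<Rightarrow> g (c []) | Suc i \<Rightarrow> h i (child_offspring c i)) UNIV"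
proof -
  interpret prob_space "offspring_space p" by (rule prob_space_offspring_space)
  define K where "K j = (case j of 0 \<Rightarrow> {[]} | Suc i \<Rightarrow> range ((#) i))" for j :: nat
  define Y where "Y j = (case j of 0 \<Rightarrow> (\<lambda>f. g (f []))
      | Suc i \<Rightarrow> (\<lambda>f. h i (\<lambda>u. f (i # u))))" for j :: nat
  have disj: "disjoint_family_on K UNIV"
    by (auto simp: disjoint_family_on_def K_def split: nat.splits)
  have ind: "indep_vars (\<lambda>j. PiM (K j) (\<lambda>_. measure_pmf p)) (\<lambda>j c. restrict (\<lambda>u. c u) (K j)) UNIV"
    by (rule indep_vars_restrict[OF indep_offspring_space _ disj]) simp
  have "Y j \<in> PiM (K j) (\<lambda>_. measure_pmf p) \<rightarrow>\<^sub>M borel" for j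
  proof (cases j)
    case 0
    have "(\<lambda>f. f []) \<in> PiM (K j) (\<lambda>_. measure_pmf p) \<rightarrow>\<^sub>M measure_pmf p"
      by (rule measurable_component_singleton) (simp add: K_def 0)
    then have "(\<lambda>f. g (f [])) \<in> PiM (K j) (\<lambda>_. measure_pmf p) \<rightarrow>\<^sub>M borel"
      by (rule measurable_compose) simp
    then show ?thesis by (simp add: Y_def 0)
  next
    case (Suc i)
    have "(\<lambda>f. f (i # u)) \<in> PiM (K j) (\<lambda>_. measure_pmf p) \<rightarrow>\<^sub>M measure_pmf p" for u
      by (rule measurable_component_singleton) (simp add: K_def Suc)
    then have "(\<lambda>f u. f (i # u)) \<in> PiM (K j) (\<lambda>_. measure_pmf p) \<rightarrow>\<^sub>M offspring_space p"
      unfolding offspring_space_def by (rule measurable_abs_UNIV)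
    from measurable_compose[OF this h[of i]] show ?thesis by (simp add: Y_def Suc)
  qed
  then have "indep_vars (\<lambda>_. borel) (\<lambda>j c. Y j (restrict (\<lambda>u. c u) (K j))) UNIV"
    by (intro indep_vars_compose2[OF ind])
  also have "(\<lambda>j c. Y j (restrict (\<lambda>u. c u) (K j)))
      = (\<lambda>j c. case j of 0 \<Rightarrow> g (c []) | Suc i \<Rightarrow> h i (child_offspring c i))"
    by (auto simp: Y_def K_def child_offspring_def fun_eq_iff split: nat.split)
  finally show ?thesis .
qed

section \<open>Sums and products over the children of the root\<close>

lemma measurable_sum_child_offspring [measurable]:
  fixes g :: "_ \<Rightarrow> 'b :: {second_countable_topology, topological_comm_monoid_add}"
  assumes [measurable]: "g \<in> borel_measurable (offspring_space p)"
  shows "(\<lambda>c. \<Sum>i<c []. g (child_offspring c i)) \<in> borel_measurable (offspring_space p)"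
  by (rule measurable_compose_countable[where g = "\<lambda>c. c []"]) measurable

text \<open>A sum or product over a random number of children is cut into slices that restrict the
  root only. Each slice is built from products of independent factors, as treated here.\<close>

lemma nn_integral_indicator_root_prod_child_offspring:
  assumes [measurable]: "\<And>i. h i \<in> borel_measurable (offspring_space p)"
  shows "(\<integral>\<^sup>+c. indicator A (c []) * (\<Prod>i<k. h i (child_offspring c i)) \<partial>offspring_space p)
    = emeasure (measure_pmf p) A * (\<Prod>i<k. \<integral>\<^sup>+c. h i c \<partial>offspring_space p)"
proof -
  interpret prob_space "offspring_space p" by (rule prob_space_offspring_space)
  let ?X = "\<lambda>j c. case j of 0 \<Rightarrow> indicator A (c []) | Suc i \<Rightarrow> h i (child_offspring c i)"
  have "(\<integral>\<^sup>+c. (\<Prod>j<Suc k. ?X j c) \<partial>offspring_space p)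
      = (\<Prod>j<Suc k. \<integral>\<^sup>+c. ?X j c \<partial>offspring_space p)"
    by (intro indep_vars_nn_integral indep_vars_subset[OF indep_root_child_offspring]) auto
  then show ?thesis
    by (simp add: prod.lessThan_Suc_shift nn_integral_child_offspring nn_integral_offspring
        del: prod.lessThan_Suc)
qed

text \<open>Wald's identity. The random range becomes a series over all \<open>i\<close> weighted by
  the indicator of \<open>i < c []\<close>, which depends on the root alone and is thus independent
  of the subtree \<open>i\<close>.\<close>

lemma nn_integral_sum_child_offspring:
  assumes [measurable]: "g \<in> borel_measurable (offspring_space p)"
  shows "(\<integral>\<^sup>+c. (\<Sum>i<c []. g (child_offspring c i)) \<partial>offspring_space p)
    = (\<integral>\<^sup>+k. of_nat k \<partial>measure_pmf p) * (\<integral>\<^sup>+c. g c \<partial>offspring_space p)"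
proof -
  have sum_eq: "(\<Sum>i<k. f i) = (\<Sum>i. indicator {i<..} k * f i)" for k and f :: "nat \<Rightarrow> ennreal"
    by (subst suminf_finite[of "{..<k}"]) (auto simp: indicator_def)
  have summand: "(\<integral>\<^sup>+c. indicator {i<..} (c []) * g (child_offspring c i) \<partial>offspring_space p)
      = emeasure (measure_pmf p) {i<..} * (\<integral>\<^sup>+c. g c \<partial>offspring_space p)" for i
  proof -
    \<comment> \<open>All factors are constant except that of the child \<open>i\<close>.\<close>
    let ?h = "\<lambda>j. if j = i then g else (\<lambda>_. 1)"
    have "(\<integral>\<^sup>+c. indicator {i<..} (c []) * (\<Prod>j<Suc i. ?h j (child_offspring c j)) \<partial>offspring_space p)
        = emeasure (measure_pmf p) {i<..} * (\<Prod>j<Suc i. \<integral>\<^sup>+c. ?h j c \<partial>offspring_space p)"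
      by (rule nn_integral_indicator_root_prod_child_offspring) simp
    then show ?thesis
      using prob_space.emeasure_space_1[OF prob_space_offspring_space[of p]] by simp
  qed
  have meas: "(\<lambda>c. indicator {i<..} (c []) * g (child_offspring c i)) \<in> borel_measurable (offspring_space p)" for i
    by (intro borel_measurable_times_ennreal measurable_fun_offspring
        measurable_fun_child_offspring assms) simp
  have "(\<integral>\<^sup>+c. (\<Sum>i<c []. g (child_offspring c i)) \<partial>offspring_space p)
      = (\<integral>\<^sup>+c. (\<Sum>i. indicator {i<..} (c []) * g (child_offspring c i)) \<partial>offspring_space p)"
    by (simp only: sum_eq)
  also have "\<dots> = (\<Sum>i. emeasure (measure_pmf p) {i<..} * (\<integral>\<^sup>+c. g c \<partial>offspring_space p))"
    by (subst nn_integral_suminf) (simp_all add: summand meas)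
  also have "\<dots> = (\<Sum>i. emeasure (measure_pmf p) {i<..}) * (\<integral>\<^sup>+c. g c \<partial>offspring_space p)"
    by simp
  \<comment> \<open>The tail probabilities of the offspring law add up to its mean.\<close>
  also have "(\<Sum>i. emeasure (measure_pmf p) {i<..}) = (\<integral>\<^sup>+k. (\<Sum>i. indicator {i<..} k) \<partial>measure_pmf p)"
    by (subst nn_integral_suminf) simp_all
  also have "(\<lambda>k. \<Sum>i. indicator {i<..} k) = (of_nat :: nat \<Rightarrow> ennreal)"
    using sum_eq[of "\<lambda>_. 1"] by (simp add: fun_eq_iff)
  finally show ?thesis .
qed

text \<open>Given \<open>k\<close> children, their subtrees satisfy \<open>Q\<close> independently,
  hence the generating function of \<open>p\<close> at the probability of \<open>Q\<close>.\<close>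

lemma emeasure_all_child_offspring:
  assumes [measurable]: "Measurable.pred (offspring_space p) Q"
  shows "emeasure (offspring_space p) {c. \<forall>i<c []. Q (child_offspring c i)}
    = (\<integral>\<^sup>+k. emeasure (offspring_space p) {c. Q c} ^ k \<partial>measure_pmf p)"
proof -
  have Q [measurable]: "{c. Q c} \<in> sets (offspring_space p)"
    using assms by (simp add: pred_def)
  have Q' [measurable]: "(indicator {c. Q c} :: _ \<Rightarrow> ennreal) \<in> borel_measurable (offspring_space p)"
    using Q by (rule borel_measurable_indicator)
  have "{c. \<forall>i<c []. Q (child_offspring c i)} = {c \<in> space (offspring_space p). \<forall>i<c []. Q (child_offspring c i)}"
    by simp
  also have "\<dots> \<in> sets (offspring_space p)"
    by measurable
  finally have [measurable]: "{c. \<forall>i<c []. Q (child_offspring c i)} \<in> sets (offspring_space p)" .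
  \<comment> \<open>For each \<open>c\<close> only the term \<open>k = c []\<close> can be
    nonzero.\<close>
  have ind: "indicator {c. \<forall>i<c []. Q (child_offspring c i)} c
      = (\<Sum>k. indicator {k} (c []) * (\<Prod>i<k. indicator {c. Q c} (child_offspring c i)) :: ennreal)" for c
    by (subst suminf_finite[of "{c []}"]) (auto simp: indicator_def prod_zero_iff)
  have meas: "(\<lambda>c. indicator {k} (c []) * (\<Prod>i<k. indicator {c. Q c} (child_offspring c i)) :: ennreal)
      \<in> borel_measurable (offspring_space p)" for k
    by (intro borel_measurable_times_ennreal borel_measurable_prod_ennreal measurable_fun_offspring
        measurable_fun_child_offspring Q') simp
  have slice: "(\<integral>\<^sup>+c. indicator {k} (c []) * (\<Prod>i<k. indicator {c. Q c} (child_offspring c i)) \<partial>offspring_space p)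
      = emeasure (measure_pmf p) {k} * emeasure (offspring_space p) {c. Q c} ^ k" for k
    by (subst nn_integral_indicator_root_prod_child_offspring[OF Q']) simp
  have "emeasure (offspring_space p) {c. \<forall>i<c []. Q (child_offspring c i)}
      = (\<integral>\<^sup>+c. (\<Sum>k. indicator {k} (c []) * (\<Prod>i<k. indicator {c. Q c} (child_offspring c i)))
          \<partial>offspring_space p)"
    by (simp only: ind[symmetric]) simp
  also have "\<dots> = (\<Sum>k. emeasure (measure_pmf p) {k} * emeasure (offspring_space p) {c. Q c} ^ k)"
    by (subst nn_integral_suminf)
      (simp_all only: meas slice)
  also have "\<dots> = (\<integral>\<^sup>+k. emeasure (offspring_space p) {c. Q c} ^ k \<partial>measure_pmf p)"
    by (simp add: nn_integral_measure_pmf nn_integral_count_space_nat emeasure_pmf_single)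
  finally show ?thesis .
qed

text \<open>Once the square is expanded, products over two different subtrees integrate to zero by
  independence and centring. The diagonal contributes one term per child.\<close>

lemma nn_integral_sum_child_offspring_squared:
  fixes g :: "_ \<Rightarrow> real"
  assumes g [measurable]: "g \<in> borel_measurable (offspring_space p)"
    and int: "integrable (offspring_space p) g" and int2: "integrable (offspring_space p) (\<lambda>c. (g c)\<^sup>2)"
    and centred: "(\<integral>c. g c \<partial>offspring_space p) = 0"
  shows "(\<integral>\<^sup>+c. ennreal ((\<Sum>i<c []. g (child_offspring c i))\<^sup>2) \<partial>offspring_space p)
    = (\<integral>\<^sup>+k. of_nat k \<partial>measure_pmf p) * (\<integral>\<^sup>+c. ennreal ((g c)\<^sup>2) \<partial>offspring_space p)"
proof -
  interpret prob_space "offspring_space p" by (rule prob_space_offspring_space)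
  let ?G = "\<integral>c. (g c)\<^sup>2 \<partial>offspring_space p"
  let ?t = "\<lambda>k i j c. indicator {k} (c []) * (g (child_offspring c i) * g (child_offspring c j)) :: real"
  have cross: "integrable (offspring_space p) (?t k i j) \<and>
      (\<integral>c. ?t k i j c \<partial>offspring_space p) = (if i = j then pmf p k * ?G else 0)" for k i j
  proof -
    \<comment> \<open>\<open>h l\<close> acts on the subtree \<open>l\<close>. On the diagonal the
      two factors merge into a square, so that independence is applied to distinct indices
      only.\<close>
    define h where "h l = (if l = i then (if i = j then (\<lambda>c. (g c)\<^sup>2) else g)
        else if l = j then g else (\<lambda>_. 1))" for l
    have h [measurable]: "h l \<in> borel_measurable (offspring_space p)" for l
      by (simp add: h_def)
    have h_int: "integrable (offspring_space p) (h l)" for l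
      using int int2 by (simp add: h_def)
    let ?X = "\<lambda>l c. case l of 0 \<Rightarrow> indicator {k} (c []) :: real | Suc l' \<Rightarrow> h l' (child_offspring c l')"
    let ?I = "insert 0 (Suc ` {i, j})"
    have ind: "indep_vars (\<lambda>_. borel) ?X ?I"
      by (rule indep_vars_subset[OF indep_root_child_offspring]) auto
    have Xint: "integrable (offspring_space p) (?X l)" for l
    proof (cases l)
      case 0
      have "integrable (offspring_space p) (\<lambda>c. indicator {k} (c []) :: real)"
        by (rule integrable_const_bound[where B = 1]) (auto simp: indicator_def)
      then show ?thesis by (simp add: 0)
    qed (simp add: integrable_child_offspring h_int)
    have X: "(\<Prod>l\<in>?I. ?X l c) = ?t k i j c" for c
      by (cases "i = j") (auto simp: h_def power2_eq_square)
    have prod_int: "integrable (offspring_space p) (\<lambda>c. \<Prod>l\<in>?I. ?X l c)"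
      using ind Xint by (intro indep_vars_integrable) auto
    have prod: "(\<integral>c. (\<Prod>l\<in>?I. ?X l c) \<partial>offspring_space p)
        = (\<Prod>l\<in>?I. \<integral>c. ?X l c \<partial>offspring_space p)"
      using ind Xint by (intro indep_vars_lebesgue_integral) auto
    have root: "(\<integral>c. indicator {k} (c []) \<partial>offspring_space p) = pmf p k"
    proof -
      have "(\<integral>c. indicator {k} (c []) \<partial>offspring_space p) = (\<integral>x. (indicator {k} x :: real) \<partial>measure_pmf p)"
        using integral_distr[of "\<lambda>c. c []" "offspring_space p" "count_space UNIV" "indicator {k} :: nat \<Rightarrow> real"]
        by (simp add: distr_offspring)
      then show ?thesis by (simp add: measure_pmf_single)
    qed
    have factors: "(\<Prod>l\<in>?I. \<integral>c. ?X l c \<partial>offspring_space p)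
        = (\<integral>c. indicator {k} (c []) \<partial>offspring_space p) * (if i = j then ?G else 0)"
      using centred integral_child_offspring[of "\<lambda>c. (g c)\<^sup>2" p] integral_child_offspring[OF g]
      by (cases "i = j") (auto simp: h_def)
    have "(\<integral>c. ?t k i j c \<partial>offspring_space p) = pmf p k * (if i = j then ?G else 0)"
      using prod unfolding X factors root .
    with prod_int show ?thesis unfolding X by simp
  qed
  note cross_int = cross[THEN conjunct1]
  have sq: "indicator {k} (c []) * (\<Sum>i<k. g (child_offspring c i))\<^sup>2 = (\<Sum>i<k. \<Sum>j<k. ?t k i j c)" for k c
    by (cases "c [] = k") (simp_all add: power2_eq_square sum_product)
  have int_sq: "integrable (offspring_space p) (\<lambda>c. indicator {k} (c []) * (\<Sum>i<k. g (child_offspring c i))\<^sup>2)" for k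
    unfolding sq by (intro Bochner_Integration.integrable_sum cross_int)
  have slice: "(\<integral>\<^sup>+c. ennreal (indicator {k} (c []) * (\<Sum>i<k. g (child_offspring c i))\<^sup>2) \<partial>offspring_space p)
      = of_nat k * ennreal (pmf p k) * ennreal ?G" for k
  proof -
    have "(\<integral>\<^sup>+c. ennreal (indicator {k} (c []) * (\<Sum>i<k. g (child_offspring c i))\<^sup>2) \<partial>offspring_space p)
        = ennreal (\<integral>c. (indicator {k} (c []) * (\<Sum>i<k. g (child_offspring c i))\<^sup>2) \<partial>offspring_space p)"
      by (rule nn_integral_eq_integral[OF int_sq]) simp
    also have "(\<integral>c. (indicator {k} (c []) * (\<Sum>i<k. g (child_offspring c i))\<^sup>2) \<partial>offspring_space p)
        = (\<Sum>i<k. \<Sum>j<k. \<integral>c. ?t k i j c \<partial>offspring_space p)"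
      unfolding sq using cross_int
      by (simp only: Bochner_Integration.integral_sum Bochner_Integration.integrable_sum)
    also have "\<dots> = (\<Sum>i<k. \<Sum>j<k. if i = j then pmf p k * ?G else 0)"
      using cross by (intro sum.cong refl) blast
    also have "\<dots> = real k * pmf p k * ?G" by simp
    finally show ?thesis by (simp add: ennreal_mult ennreal_of_nat_eq_real_of_nat)
  qed
  have "(\<integral>\<^sup>+c. ennreal ((\<Sum>i<c []. g (child_offspring c i))\<^sup>2) \<partial>offspring_space p)
      = (\<integral>\<^sup>+c. (\<Sum>k. ennreal (indicator {k} (c []) * (\<Sum>i<k. g (child_offspring c i))\<^sup>2)) \<partial>offspring_space p)"
  proof (rule nn_integral_cong)
    fix c
    show "ennreal ((\<Sum>i<c []. g (child_offspring c i))\<^sup>2)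
        = (\<Sum>k. ennreal (indicator {k} (c []) * (\<Sum>i<k. g (child_offspring c i))\<^sup>2))"
      by (subst suminf_finite[of "{c []}"]) auto
  qed
  also have "\<dots> = (\<Sum>k. of_nat k * ennreal (pmf p k) * ennreal ?G)"
    by (subst nn_integral_suminf)
      (simp_all only: slice measurable_compose[OF borel_measurable_integrable[OF int_sq] measurable_ennreal])
  also have "\<dots> = (\<integral>\<^sup>+k. of_nat k \<partial>measure_pmf p) * ennreal ?G"
    by (simp add: nn_integral_measure_pmf nn_integral_count_space_nat mult.commute)
  also have "ennreal ?G = (\<integral>\<^sup>+c. ennreal ((g c)\<^sup>2) \<partial>offspring_space p)"
    by (rule nn_integral_eq_integral[symmetric]) (simp_all add: int2)
  finally show ?thesis .
qed

lemma integrable_offspring: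
  fixes g :: "nat \<Rightarrow> real"
  assumes "integrable (measure_pmf p) g"
  shows "integrable (offspring_space p) (\<lambda>c. g (c u))"
  by (rule integrable_distr[OF measurable_offspring]) (simp add: distr_offspring assms)

text \<open>Unrolled, this adds up \<open>g\<close> over the subtrees rooted at all vertices of
  height \<open>k\<close>. With \<open>envelope\<close> for \<open>g\<close> it is the sum
  \<open>S\<^sub>k\<close> of the introduction.\<close>

primrec level_sum :: "((nat list \<Rightarrow> nat) \<Rightarrow> ennreal) \<Rightarrow> nat \<Rightarrow> (nat list \<Rightarrow> nat) \<Rightarrow> ennreal" where
  "level_sum g 0 c = g c"
| "level_sum g (Suc k) c = (\<Sum>i<c []. level_sum g k (child_offspring c i))"

lemma measurable_level_sum [measurable]:
  assumes [measurable]: "g \<in> borel_measurable (offspring_space p)"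
  shows "level_sum g k \<in> borel_measurable (offspring_space p)"
  by (induction k) simp_all

lemma nn_integral_level_sum:
  assumes [measurable]: "g \<in> borel_measurable (offspring_space p)"
  shows "(\<integral>\<^sup>+c. level_sum g k c \<partial>offspring_space p)
    = (\<integral>\<^sup>+j. of_nat j \<partial>measure_pmf p) ^ k * (\<integral>\<^sup>+c. g c \<partial>offspring_space p)"
  by (induction k) (simp_all add: nn_integral_sum_child_offspring mult.assoc)

lemma measurable_gen_size [measurable]:
  "(\<lambda>c. real (gen_size c n)) \<in> borel_measurable (offspring_space p)"
proof (induction n)
  case (Suc n)
  from measurable_sum_child_offspring[OF this] show ?case by (simp add: gen_size_Suc)
qed simp

section \<open>Growth of the generations\<close>

lemma power_convex_strict:
  fixes e q :: real
  assumes "0 \<le> e" "e < q" "q < 1"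
  defines "\<theta> \<equiv> (1 - q) / (1 - e)"
  shows "q ^ k \<le> \<theta> * e ^ k + (1 - \<theta>)"
    and "k \<ge> 2 \<Longrightarrow> q ^ k < \<theta> * e ^ k + (1 - \<theta>)"
proof -
  have \<theta>: "\<theta> > 0" "\<theta> * (1 - e) = 1 - q" using assms by (auto simp: \<theta>_def)
  then have q: "q = 1 - \<theta> * (1 - e)" by simp
  \<comment> \<open>\<open>q\<close> is the mixture of \<open>e\<close> and 1 with weights
    \<open>\<theta>\<close> and \<open>1 - \<theta>\<close>. The last term is the covariance of
    \<open>x\<close> and \<open>x ^ k\<close> under this two-point law: the convexity gained by
    raising the exponent.\<close>
  have step: "\<theta> * e ^ Suc k + (1 - \<theta>) = q * (\<theta> * e ^ k + (1 - \<theta>)) + \<theta> * (q - e) * (1 - e ^ k)" for k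
    unfolding q power_Suc by algebra
  have le: "q ^ k \<le> \<theta> * e ^ k + (1 - \<theta>)" for k
  proof (induction k)
    case (Suc k)
    have "q ^ Suc k \<le> q * (\<theta> * e ^ k + (1 - \<theta>))"
      using Suc assms by (simp add: mult_left_mono)
    moreover have "0 \<le> \<theta> * (q - e) * (1 - e ^ k)"
      using \<theta> assms by (intro mult_nonneg_nonneg) (auto simp: power_le_one)
    ultimately show ?case unfolding step by linarith
  qed simp
  show "q ^ k \<le> \<theta> * e ^ k + (1 - \<theta>)" by (rule le)
  assume "k \<ge> 2"
  then obtain j where k: "k = Suc j" and j: "j \<ge> 1" by (cases k) auto
  have "q ^ k \<le> q * (\<theta> * e ^ j + (1 - \<theta>))"
    using le[of j] assms by (simp add: k mult_left_mono)
  moreover have "e ^ j < 1"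
    using assms j by (simp add: power_less_one_iff)
  then have "0 < \<theta> * (q - e) * (1 - e ^ j)"
    using \<theta> assms by (intro mult_pos_pos) auto
  ultimately show "q ^ k < \<theta> * e ^ k + (1 - \<theta>)" unfolding k step by linarith
qed

text \<open>If \<open>e < q < 1\<close>, the generating function would meet the diagonal at the
  three points \<open>e\<close>, \<open>q\<close> and 1. Convexity then forces \<open>p\<close> to
  live on 0 and 1, against a mean above 1.\<close>

lemma strict_convexity_fixed_points:
  fixes e q :: real
  assumes int: "integrable (measure_pmf p) real" and mean: "measure_pmf.expectation p real > 1"
    and e: "0 \<le> e" "measure_pmf.expectation p (\<lambda>k. e ^ k) = e"
    and q: "q < 1" "measure_pmf.expectation p (\<lambda>k. q ^ k) = q"
  shows "q \<le> e"
proof (rule ccontr)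
  assume "\<not> q \<le> e"
  then have less: "e < q" by simp
  define w where "w = (1 - q) / (1 - e)"
  define h where "h k = w * e ^ k + (1 - w) - q ^ k" for k :: nat
  have h: "h k \<ge> 0" "k \<ge> 2 \<Longrightarrow> h k > 0" for k
    using power_convex_strict[OF e(1) less q(1), of k] by (auto simp: h_def w_def)
  have pow_int: "integrable (measure_pmf p) (\<lambda>k. x ^ k)" if "0 \<le> x" "x < 1" for x :: real
    using that by (intro measure_pmf.integrable_const_bound[where B = 1])
      (auto simp: power_le_one)
  have ints: "integrable (measure_pmf p) (\<lambda>k. e ^ k)" "integrable (measure_pmf p) (\<lambda>k. q ^ k)"
    using e q less by (auto intro!: pow_int)
  have "w * (1 - e) = 1 - q" using less q by (simp add: w_def)
  \<comment> \<open>The fixed-point equations turn the expected convexity gap into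
    \<open>w * e + (1 - w) - q\<close>, which vanishes by the choice of \<open>w\<close>.\<close>
  then have "measure_pmf.expectation p h = 0"
    unfolding h_def using ints by (simp add: e(2) q(2)) (simp add: algebra_simps)
  moreover have "integrable (measure_pmf p) h"
    unfolding h_def using ints by simp
  ultimately have "AE k in measure_pmf p. h k = 0"
    using integral_nonneg_eq_0_iff_AE[of "measure_pmf p" h] h(1) by simp
  moreover have "real k \<le> 1" if "h k = 0" for k
    using h(2)[of k] that by (cases "k \<ge> 2") auto
  ultimately have "AE k in measure_pmf p. real k \<le> 1"
    by (auto elim: eventually_mono)
  then have "measure_pmf.expectation p real \<le> measure_pmf.expectation p (\<lambda>_. 1)"
    using int by (intro integral_mono_AE) auto
  with mean show False by simp
qed

text \<open>For properties inherited by all subtrees of the children, in both directions. Extinction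
  and a vanishing limit of \<open>norm_size\<close> are of this kind.\<close>

lemma prob_fixed_point:
  assumes Q [measurable]: "Measurable.pred (offspring_space p) Q"
    and rec: "\<And>c. Q c \<longleftrightarrow> (\<forall>i<c []. Q (child_offspring c i))"
  defines "q \<equiv> measure (offspring_space p) {c. Q c}"
  shows "measure_pmf.expectation p (\<lambda>k. q ^ k) = q"
proof -
  interpret prob_space "offspring_space p" by (rule prob_space_offspring_space)
  have q: "0 \<le> q" "q \<le> 1" by (auto simp: q_def)
  have "ennreal q = emeasure (offspring_space p) {c. Q c}"
    by (simp add: q_def emeasure_eq_measure)
  also have "{c. Q c} = {c. \<forall>i<c []. Q (child_offspring c i)}"
    by (rule Collect_cong) (rule rec)
  also have "emeasure (offspring_space p) \<dots> = (\<integral>\<^sup>+k. ennreal (q ^ k) \<partial>measure_pmf p)"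
    unfolding emeasure_all_child_offspring[OF Q]
    by (rule nn_integral_cong) (simp add: emeasure_eq_measure ennreal_power q_def)
  also have "\<dots> = ennreal (measure_pmf.expectation p (\<lambda>k. q ^ k))"
    using q by (intro nn_integral_eq_integral measure_pmf.integrable_const_bound[where B = 1])
      (auto simp: power_le_one)
  finally show ?thesis using q by (simp add: integral_nonneg)
qed

section \<open>Normalized generation sizes\<close>

locale supercritical =
  fixes p :: "nat pmf" and m :: real
  defines "m \<equiv> measure_pmf.expectation p real"
  assumes integrable_offspring_number: "integrable (measure_pmf p) real"
    and supercritical: "m > 1"
    and integrable_offspring_number_sq: "integrable (measure_pmf p) (\<lambda>k. (real k)\<^sup>2)"
begin

lemma m_pos: "m > 0" "m \<noteq> 0"
  using supercritical by auto

lemma nn_integral_offspring_number: "(\<integral>\<^sup>+k. of_nat k \<partial>measure_pmf p) = ennreal m"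
  using nn_integral_eq_integral[OF integrable_offspring_number]
  by (simp add: m_def ennreal_of_nat_eq_real_of_nat)

definition norm_size :: "nat \<Rightarrow> (nat list \<Rightarrow> nat) \<Rightarrow> real" where
  "norm_size n c = gen_size c n / m ^ n"

definition increment :: "nat \<Rightarrow> (nat list \<Rightarrow> nat) \<Rightarrow> real" where
  "increment n c = norm_size (Suc n) c - norm_size n c"

lemma norm_size_0 [simp]: "norm_size 0 c = 1"
  by (simp add: norm_size_def)

lemma norm_size_nonneg: "norm_size n c \<ge> 0"
  using m_pos by (simp add: norm_size_def)

lemma norm_size_Suc: "norm_size (Suc n) c = (\<Sum>i<c []. norm_size n (child_offspring c i)) / m"
  by (simp add: norm_size_def gen_size_Suc sum_divide_distrib[symmetric] mult.commute)

text \<open>Increments inherit the recursion at the root, so their moments follow by induction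
  without conditional expectations.\<close>

lemma increment_Suc: "increment (Suc n) c = (\<Sum>i<c []. increment n (child_offspring c i)) / m"
  unfolding increment_def
  by (subst (1 2) norm_size_Suc) (simp add: diff_divide_distrib sum_subtractf)

lemma norm_size_eq_sum: "norm_size n c = 1 + (\<Sum>j<n. increment j c)"
  unfolding increment_def by (subst sum_lessThan_telescope) simp

lemma measurable_norm_size [measurable]: "norm_size n \<in> borel_measurable (offspring_space p)"
  unfolding norm_size_def by measurable

lemma measurable_increment [measurable]: "increment n \<in> borel_measurable (offspring_space p)"
  unfolding increment_def by measurable

text \<open>The factor \<open>m\<close> from Wald's identity cancels the division by
  \<open>m\<close>. Working with the nonnegative integral gives integrability and the mean
  together.\<close>

lemma norm_size_mean:
  "integrable (offspring_space p) (norm_size n)" "(\<integral>c. norm_size n c \<partial>offspring_space p) = 1"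
proof -
  interpret prob_space "offspring_space p" by (rule prob_space_offspring_space)
  have "(\<integral>\<^sup>+c. ennreal (norm_size n c) \<partial>offspring_space p) = 1"
  proof (induction n)
    case (Suc n)
    have "ennreal (norm_size (Suc n) c) = ennreal (1 / m) * (\<Sum>i<c []. ennreal (norm_size n (child_offspring c i)))" for c
      using m_pos by (simp add: norm_size_Suc norm_size_nonneg sum_nonneg ennreal_mult[symmetric])
    then have "(\<integral>\<^sup>+c. ennreal (norm_size (Suc n) c) \<partial>offspring_space p)
        = ennreal (1 / m) * (ennreal m * (\<integral>\<^sup>+c. ennreal (norm_size n c) \<partial>offspring_space p))"
      using nn_integral_sum_child_offspring[of "\<lambda>c. ennreal (norm_size n c)" p]
      by (simp add: nn_integral_cmult nn_integral_offspring_number)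
    also have "\<dots> = 1"
      unfolding Suc using m_pos by (simp add: ennreal_mult[symmetric])
    finally show ?case .
  qed (simp add: emeasure_space_1[simplified])
  then have "integrable (offspring_space p) (norm_size n) \<and> (\<integral>c. norm_size n c \<partial>offspring_space p) = 1"
    using nn_integral_eq_integrable[of "norm_size n" "offspring_space p" 1]
    by (simp add: norm_size_nonneg)
  then show "integrable (offspring_space p) (norm_size n)" "(\<integral>c. norm_size n c \<partial>offspring_space p) = 1"
    by auto
qed

lemma increment_mean:
  "integrable (offspring_space p) (increment n)" "(\<integral>c. increment n c \<partial>offspring_space p) = 0"
  unfolding increment_def using norm_size_mean by simp_all

definition increment_var :: real where
  "increment_var = (\<integral>c. (increment 0 c)\<^sup>2 \<partial>offspring_space p)"

text \<open>The children contribute independent centred terms, so each generation multiplies the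
  second moment by \<open>m\<close> and divides it by \<open>m\<^sup>2\<close>. Integrability
  belongs to the induction because the next step needs it.\<close>

lemma increment_second_moment:
  "integrable (offspring_space p) (\<lambda>c. (increment n c)\<^sup>2)"
  "(\<integral>\<^sup>+c. ennreal ((increment n c)\<^sup>2) \<partial>offspring_space p) = ennreal (increment_var / m ^ n)"
proof -
  interpret prob_space "offspring_space p" by (rule prob_space_offspring_space)
  have "integrable (offspring_space p) (\<lambda>c. (increment n c)\<^sup>2) \<and>
      (\<integral>\<^sup>+c. ennreal ((increment n c)\<^sup>2) \<partial>offspring_space p) = ennreal (increment_var / m ^ n)"
  proof (induction n)
    case 0
    have "increment 0 c = real (c []) / m - 1" for c
      by (simp add: increment_def norm_size_Suc)
    then have eq: "(increment 0 c)\<^sup>2 = (real (c []))\<^sup>2 / m\<^sup>2 - 2 * real (c []) / m + 1" for c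
      by (simp add: power2_diff power_divide)
    have "integrable (offspring_space p) (\<lambda>c. (increment 0 c)\<^sup>2)"
      unfolding eq using integrable_offspring[OF integrable_offspring_number, of "[]"]
        integrable_offspring[OF integrable_offspring_number_sq, of "[]"]
      by simp
    then show ?case
      by (simp add: nn_integral_eq_integral increment_var_def)
  next
    case (Suc n)
    have "ennreal ((increment (Suc n) c)\<^sup>2)
        = ennreal (1 / m\<^sup>2) * ennreal ((\<Sum>i<c []. increment n (child_offspring c i))\<^sup>2)" for c
      by (simp add: increment_Suc power_divide ennreal_mult[symmetric])
    then have "(\<integral>\<^sup>+c. ennreal ((increment (Suc n) c)\<^sup>2) \<partial>offspring_space p)
        = ennreal (1 / m\<^sup>2) * (ennreal m * ennreal (increment_var / m ^ n))"
      using Suc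
      by (simp add: nn_integral_cmult nn_integral_offspring_number increment_mean
          nn_integral_sum_child_offspring_squared)
    also have "\<dots> = ennreal (1 / m\<^sup>2 * (m * (increment_var / m ^ n)))"
      using m_pos by (simp only: ennreal_mult'[of "1 / m\<^sup>2"] ennreal_mult'[of m] less_imp_le
          zero_le_divide_1_iff zero_le_power2)
    also have "1 / m\<^sup>2 * (m * (increment_var / m ^ n)) = increment_var / m ^ Suc n"
      using m_pos by (simp add: power2_eq_square)
    finally have *: "(\<integral>\<^sup>+c. ennreal ((increment (Suc n) c)\<^sup>2) \<partial>offspring_space p)
        = ennreal (increment_var / m ^ Suc n)" .
    then have "integrable (offspring_space p) (\<lambda>c. (increment (Suc n) c)\<^sup>2)"
      by (intro integrableI_nonneg) auto
    with * show ?case by blast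
  qed
  then show "integrable (offspring_space p) (\<lambda>c. (increment n c)\<^sup>2)"
    "(\<integral>\<^sup>+c. ennreal ((increment n c)\<^sup>2) \<partial>offspring_space p) = ennreal (increment_var / m ^ n)"
    by auto
qed

text \<open>
  An integrable bound for all squared normalized generation sizes at once, coming from the
  Cauchy--Schwarz inequality for the telescoping sum with geometric weights.
\<close>

definition envelope :: "(nat list \<Rightarrow> nat) \<Rightarrow> ennreal" where
  "envelope c = 2 + ennreal (2 / (1 - 1 / sqrt m)) * (\<Sum>j. ennreal ((increment j c)\<^sup>2 * sqrt m ^ j))"

lemma measurable_envelope [measurable]: "envelope \<in> borel_measurable (offspring_space p)"
  unfolding envelope_def by measurable

lemma sqrt_m: "sqrt m > 1" "1 / sqrt m < 1" "1 / sqrt m \<ge> 0"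
  using supercritical by auto

text \<open>Against second moments of order \<open>1 / m ^ j\<close>, the weights
  \<open>sqrt m ^ j\<close> still leave a convergent geometric series of ratio
  \<open>1 / sqrt m\<close>.\<close>

lemma nn_integral_envelope: "(\<integral>\<^sup>+c. envelope c \<partial>offspring_space p) < \<infinity>"
proof -
  interpret prob_space "offspring_space p" by (rule prob_space_offspring_space)
  have var: "increment_var \<ge> 0" by (simp add: increment_var_def)
  have summand: "(\<integral>\<^sup>+c. ennreal ((increment j c)\<^sup>2 * sqrt m ^ j) \<partial>offspring_space p)
      = ennreal (increment_var * (1 / sqrt m) ^ j)" for j
  proof -
    have "(\<integral>\<^sup>+c. ennreal ((increment j c)\<^sup>2 * sqrt m ^ j) \<partial>offspring_space p)
        = (\<integral>\<^sup>+c. ennreal ((increment j c)\<^sup>2) * ennreal (sqrt m ^ j) \<partial>offspring_space p)"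
      using m_pos by (intro nn_integral_cong) (simp add: ennreal_mult)
    also have "\<dots> = ennreal (increment_var / m ^ j) * ennreal (sqrt m ^ j)"
      by (simp add: nn_integral_multc increment_second_moment)
    also have "\<dots> = ennreal (increment_var / m ^ j * sqrt m ^ j)"
      using m_pos by (subst ennreal_mult'') simp_all
    also have "m ^ j = sqrt m ^ j * sqrt m ^ j"
      using m_pos by (simp add: power_mult_distrib[symmetric])
    also have "increment_var / (sqrt m ^ j * sqrt m ^ j) * sqrt m ^ j = increment_var * (1 / sqrt m) ^ j"
      using m_pos by (simp add: power_divide)
    finally show ?thesis .
  qed
  have "(\<Sum>j. ennreal (increment_var * (1 / sqrt m) ^ j)) = ennreal (\<Sum>j. increment_var * (1 / sqrt m) ^ j)"
    using var sqrt_m by (intro suminf_ennreal2) (auto intro!: summable_mult summable_geometric)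
  then show ?thesis
    unfolding envelope_def
    by (simp add: nn_integral_add nn_integral_cmult nn_integral_suminf summand
        emeasure_space_1[simplified] ennreal_mult_less_top)
qed

lemma norm_size_squared_le_envelope: "ennreal ((norm_size n c)\<^sup>2) \<le> envelope c"
proof -
  \<comment> \<open>With the fourth root of \<open>m\<close>, the squares of \<open>t ^ j\<close>
    are the weights in \<open>envelope\<close>, and the squares of the reciprocals are
    summable.\<close>
  define t where "t = sqrt (sqrt m)"
  have t: "t > 0" "t\<^sup>2 = sqrt m" using m_pos by (simp_all add: t_def)
  define s where "s = (\<Sum>j<n. increment j c)"
  have "s\<^sup>2 = (\<Sum>j<n. (1 / t) ^ j * (t ^ j * increment j c))\<^sup>2"
    unfolding s_def using t by (simp add: power_divide)
  also have "\<dots> \<le> (\<Sum>j<n. ((1 / t) ^ j)\<^sup>2) * (\<Sum>j<n. (t ^ j * increment j c)\<^sup>2)"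
    by (rule Cauchy_Schwarz_ineq_sum)
  also have "(\<Sum>j<n. ((1 / t) ^ j)\<^sup>2) = (\<Sum>j<n. (1 / sqrt m) ^ j)"
    by (simp add: t(2)[symmetric] power_divide power_mult[symmetric] mult.commute[of _ 2])
  also have "(\<Sum>j<n. (t ^ j * increment j c)\<^sup>2) = (\<Sum>j<n. (increment j c)\<^sup>2 * sqrt m ^ j)"
    by (simp add: t(2)[symmetric] power_mult_distrib power_mult[symmetric] mult.commute[of _ 2] mult.commute[of "t ^ _"])
  also have "(\<Sum>j<n. (1 / sqrt m) ^ j) * (\<Sum>j<n. (increment j c)\<^sup>2 * sqrt m ^ j)
      \<le> 1 / (1 - 1 / sqrt m) * (\<Sum>j<n. (increment j c)\<^sup>2 * sqrt m ^ j)"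
  proof (rule mult_right_mono)
    have "(\<Sum>j<n. (1 / sqrt m) ^ j) \<le> (\<Sum>j. (1 / sqrt m) ^ j)"
      using sqrt_m by (intro sum_le_suminf summable_geometric) auto
    then show "(\<Sum>j<n. (1 / sqrt m) ^ j) \<le> 1 / (1 - 1 / sqrt m)"
      using sqrt_m by (subst (asm) suminf_geometric) auto
  qed (use m_pos in \<open>auto intro!: sum_nonneg\<close>)
  finally have s: "s\<^sup>2 \<le> 1 / (1 - 1 / sqrt m) * (\<Sum>j<n. (increment j c)\<^sup>2 * sqrt m ^ j)" .
  have "(norm_size n c)\<^sup>2 = (1 + s)\<^sup>2" by (simp add: norm_size_eq_sum s_def)
  \<comment> \<open>This inequality is the origin of both constants 2 in
    \<open>envelope\<close>.\<close>
  also have "\<dots> \<le> 2 + 2 * s\<^sup>2"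
    using zero_le_power2[of "1 - s"] by (simp add: power2_eq_square algebra_simps)
  also have "\<dots> \<le> 2 + 2 / (1 - 1 / sqrt m) * (\<Sum>j<n. (increment j c)\<^sup>2 * sqrt m ^ j)"
    using s by simp
  finally have "ennreal ((norm_size n c)\<^sup>2)
      \<le> ennreal (2 + 2 / (1 - 1 / sqrt m) * (\<Sum>j<n. (increment j c)\<^sup>2 * sqrt m ^ j))"
    by (rule ennreal_leI)
  also have "\<dots> = 2 + ennreal (2 / (1 - 1 / sqrt m)) * (\<Sum>j<n. ennreal ((increment j c)\<^sup>2 * sqrt m ^ j))"
  proof -
    have "0 \<le> 2 / (1 - 1 / sqrt m)" "\<And>j. 0 \<le> (increment j c)\<^sup>2 * sqrt m ^ j"
      using sqrt_m m_pos by simp_all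
    then show ?thesis
      by (simp only: sum_ennreal ennreal_plus ennreal_mult sum_nonneg mult_nonneg_nonneg) simp
  qed
  also have "\<dots> \<le> envelope c"
    unfolding envelope_def by (intro add_left_mono mult_left_mono sum_le_suminf) auto
  finally show ?thesis .
qed

text \<open>The telescoping series converges absolutely: by the inequality of arithmetic and
  geometric means, an increment is at most its weighted square plus a geometric term.\<close>

lemma convergent_norm_size:
  assumes "envelope c < \<infinity>"
  shows "convergent (\<lambda>n. norm_size n c)"
proof -
  define f where "f j = (increment j c)\<^sup>2 * sqrt m ^ j" for j
  have nonneg: "0 \<le> f j" for j using m_pos by (simp add: f_def)
  have finite: "(\<Sum>j. ennreal (f j)) \<noteq> top"
  proof
    assume "(\<Sum>j. ennreal (f j)) = top"
    \<comment> \<open>In \<open>ennreal\<close> zero times \<open>top\<close> is zero, so the factor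
      must be nonzero for the infinite series to make \<open>envelope\<close> infinite.\<close>
    moreover have "ennreal (2 / (1 - 1 / sqrt m)) \<noteq> 0"
      using sqrt_m by simp
    ultimately have "envelope c = top"
      by (simp add: envelope_def f_def ennreal_mult_eq_top_iff)
    with assms show False by simp
  qed
  have f: "summable f" by (rule summable_suminf_not_top[OF nonneg finite])
  have "norm (increment j c) \<le> f j + (1 / sqrt m) ^ j" for j
  proof -
    let ?a = "sqrt (sqrt m) ^ j"
    have "?a\<^sup>2 = ((sqrt (sqrt m))\<^sup>2) ^ j"
      by (simp only: power2_eq_square power_mult_distrib)
    also have "(sqrt (sqrt m))\<^sup>2 = sqrt m" using m_pos by simp
    finally have a1: "?a\<^sup>2 = sqrt m ^ j" .
    have a2: "?a > 0" using m_pos by simp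
    have "2 * \<bar>increment j c\<bar> \<le> (?a * \<bar>increment j c\<bar>)\<^sup>2 + (1 / ?a)\<^sup>2"
      using zero_le_power2[of "?a * \<bar>increment j c\<bar> - 1 / ?a"] a2 m_pos(2) by (simp add: power2_diff)
    also have "\<dots> = f j + (1 / sqrt m) ^ j"
      unfolding power_mult_distrib power_divide a1 by (simp add: f_def power_divide)
    finally show ?thesis by simp
  qed
  then have "summable (\<lambda>j. increment j c)"
    using sqrt_m by (intro summable_comparison_test'[OF summable_add[OF f summable_geometric]]) auto
  then have "(\<lambda>n. 1 + (\<Sum>j<n. increment j c)) \<longlonglongrightarrow> 1 + (\<Sum>j. increment j c)"
    by (intro tendsto_intros summable_LIMSEQ)
  then show ?thesis
    unfolding convergent_def norm_size_eq_sum by blast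
qed

lemma AE_envelope_finite: "AE c in offspring_space p. envelope c < \<infinity>"
  using nn_integral_PInf_AE[of envelope "offspring_space p"] nn_integral_envelope
  by (auto simp: less_top)

section \<open>Extinction and vanishing of the limit\<close>

definition dies_out :: "(nat list \<Rightarrow> nat) \<Rightarrow> bool" where
  "dies_out c \<longleftrightarrow> (\<exists>n. gen_size c n = 0)"

definition degenerate :: "(nat list \<Rightarrow> nat) \<Rightarrow> bool" where
  "degenerate c \<longleftrightarrow> (\<lambda>n. norm_size n c) \<longlonglongrightarrow> 0"

lemma measurable_dies_out [measurable]: "Measurable.pred (offspring_space p) dies_out"
proof -
  have "dies_out = (\<lambda>c. \<exists>n. real (gen_size c n) = 0)" by (simp add: dies_out_def fun_eq_iff)
  moreover have "Measurable.pred (offspring_space p) (\<lambda>c. \<exists>n. real (gen_size c n) = 0)"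
    by measurable
  ultimately show ?thesis by simp
qed

lemma measurable_degenerate [measurable]: "Measurable.pred (offspring_space p) degenerate"
  unfolding degenerate_def by measurable

lemma dies_out_rec: "dies_out c \<longleftrightarrow> (\<forall>i<c []. dies_out (child_offspring c i))"
proof
  assume "dies_out c"
  then obtain n where "gen_size c n = 0" by (auto simp: dies_out_def)
  then have "gen_size c (Suc n) = 0" by (auto intro: gen_size_eq_0_mono)
  then show "\<forall>i<c []. dies_out (child_offspring c i)"
    by (auto simp: dies_out_def gen_size_Suc)
next
  assume "\<forall>i<c []. dies_out (child_offspring c i)"
  then obtain n where n: "\<And>i. i < c [] \<Longrightarrow> gen_size (child_offspring c i) (n i) = 0"
    unfolding dies_out_def by metis
  \<comment> \<open>The sum dominates each of the finitely many extinction times, hence is a common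
    one.\<close>
  define N where "N = (\<Sum>i<c []. n i)"
  have "gen_size (child_offspring c i) N = 0" if "i < c []" for i
    using n[OF that] by (rule gen_size_eq_0_mono) (use that in \<open>auto simp: N_def intro: member_le_sum\<close>)
  then show "dies_out c" unfolding dies_out_def by (intro exI[of _ "Suc N"]) (simp add: gen_size_Suc)
qed

text \<open>A finite sum of nonnegative sequences tends to zero exactly when each of them
  does.\<close>

lemma degenerate_rec: "degenerate c \<longleftrightarrow> (\<forall>i<c []. degenerate (child_offspring c i))"
proof
  assume "degenerate c"
  then have "(\<lambda>n. norm_size (Suc n) c) \<longlonglongrightarrow> 0"
    unfolding degenerate_def by (rule LIMSEQ_Suc)
  from tendsto_mult_left_zero[OF this, of m]
  have lim: "(\<lambda>n. \<Sum>i<c []. norm_size n (child_offspring c i)) \<longlonglongrightarrow> 0"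
    using m_pos by (simp add: norm_size_Suc)
  show "\<forall>i<c []. degenerate (child_offspring c i)"
    unfolding degenerate_def
  proof (intro allI impI)
    fix i assume "i < c []"
    then show "(\<lambda>n. norm_size n (child_offspring c i)) \<longlonglongrightarrow> 0"
      by (intro tendsto_sandwich[OF _ _ tendsto_const lim] always_eventually allI norm_size_nonneg
          member_le_sum) (auto simp: norm_size_nonneg)
  qed
next
  assume "\<forall>i<c []. degenerate (child_offspring c i)"
  then have "(\<lambda>n. (\<Sum>i<c []. norm_size n (child_offspring c i)) / m) \<longlonglongrightarrow> 0"
    unfolding degenerate_def by (intro tendsto_divide_zero tendsto_null_sum) auto
  then show "degenerate c"
    unfolding degenerate_def norm_size_Suc[symmetric] by (rule LIMSEQ_imp_Suc)
qed

text \<open>Otherwise dominated convergence would send the means, all equal to 1, to 0. The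
  dominating function comes from \<open>envelope\<close> and from
  \<open>x \<le> 1 + x\<^sup>2\<close>.\<close>

lemma prob_degenerate_less_1: "measure (offspring_space p) {c. degenerate c} < 1"
proof (rule ccontr)
  interpret prob_space "offspring_space p" by (rule prob_space_offspring_space)
  assume "\<not> measure (offspring_space p) {c. degenerate c} < 1"
  then have "prob {c \<in> space (offspring_space p). degenerate c} = 1"
    by (simp add: antisym not_less)
  then have "AE c in offspring_space p. degenerate c"
    by (subst (asm) prob_Collect_eq_1) (use measurable_degenerate in \<open>auto simp: pred_def\<close>)
  then have lim: "AE c in offspring_space p. (\<lambda>n. norm_size n c) \<longlonglongrightarrow> 0"
    by (simp add: degenerate_def)
  have int: "integrable (offspring_space p) (\<lambda>c. 1 + enn2real (envelope c))"
  proof -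
    have "(\<integral>\<^sup>+c. ennreal (enn2real (envelope c)) \<partial>offspring_space p) < \<infinity>"
      by (rule le_less_trans[OF nn_integral_mono nn_integral_envelope]) (simp add: ennreal_enn2real_if)
    then have "integrable (offspring_space p) (\<lambda>c. enn2real (envelope c))"
      by (intro integrableI_nonneg) auto
    then show ?thesis by simp
  qed
  have bound: "AE c in offspring_space p. norm (norm_size n c) \<le> 1 + enn2real (envelope c)" for n
    using AE_envelope_finite
  proof eventually_elim
    case (elim c)
    have "(norm_size n c)\<^sup>2 \<le> enn2real (envelope c)"
      using enn2real_mono[OF norm_size_squared_le_envelope[of n c]] elim by simp
    moreover have "norm_size n c \<le> 1 + (norm_size n c)\<^sup>2"
      using zero_le_power2[of "norm_size n c - 1"] norm_size_nonneg[of n c]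
      by (simp add: power2_diff)
    ultimately show ?case by (simp add: norm_size_nonneg)
  qed
  have "(\<lambda>n. \<integral>c. norm_size n c \<partial>offspring_space p) \<longlonglongrightarrow> (\<integral>c. 0 \<partial>offspring_space p)"
    by (rule integral_dominated_convergence[OF _ _ int lim bound]) auto
  then show False by (simp add: norm_size_mean LIMSEQ_const_iff)
qed

lemma AE_survival_growth:
  "AE c in offspring_space p. infinite (ulam_harris_tree c) \<longrightarrow>
     (\<exists>a>0. \<forall>\<^sub>F n in sequentially. a * m ^ n \<le> gen_size c n)"
proof -
  interpret prob_space "offspring_space p" by (rule prob_space_offspring_space)
  let ?e = "measure (offspring_space p) {c. dies_out c}"
  let ?q = "measure (offspring_space p) {c. degenerate c}"
  have [measurable]: "{c. dies_out c} \<in> events" "{c. degenerate c} \<in> events"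
    using measurable_dies_out measurable_degenerate by (simp_all add: pred_def)
  \<comment> \<open>Extinction plays the part of the nonnegative fixed point \<open>e\<close>,
    degeneracy that of the fixed point known to be below 1.\<close>
  have "?q \<le> ?e"
  proof (rule strict_convexity_fixed_points[OF integrable_offspring_number])
    show "measure_pmf.expectation p real > 1" using supercritical by (simp add: m_def)
  qed (simp_all add: prob_degenerate_less_1
      prob_fixed_point[OF measurable_dies_out dies_out_rec]
      prob_fixed_point[OF measurable_degenerate degenerate_rec])
  moreover have sub: "{c. dies_out c} \<subseteq> {c. degenerate c}"
  proof safe
    fix c assume "dies_out c"
    then obtain n where "gen_size c n = 0" by (auto simp: dies_out_def)
    then have "norm_size k c = 0" if "k \<ge> n" for k
      using that by (simp add: norm_size_def gen_size_eq_0_mono)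
    then have "\<forall>\<^sub>F k in sequentially. norm_size k c = 0"
      unfolding eventually_sequentially by blast
    then show "degenerate c" unfolding degenerate_def by (rule tendsto_eventually)
  qed
  \<comment> \<open>An inclusion together with the reverse inequality of probabilities: the two
    events differ by a null set.\<close>
  ultimately have "prob ({c. degenerate c} - {c. dies_out c}) = 0"
    by (subst finite_measure_Diff) (use finite_measure_mono[OF sub] in auto)
  then have "AE c in offspring_space p. c \<notin> {c. degenerate c} - {c. dies_out c}"
    by (intro AE_not_in) (simp add: null_sets_def emeasure_eq_measure)
  then show ?thesis
    using AE_envelope_finite
  proof eventually_elim
    case (elim c)
    show ?case
    proof
      assume "infinite (ulam_harris_tree c)"
      then have "\<not> dies_out c" by (simp add: infinite_tree_iff dies_out_def)
      then have nondeg: "\<not> degenerate c" using elim(1) by simp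
      obtain L where L: "(\<lambda>n. norm_size n c) \<longlonglongrightarrow> L"
        using convergent_norm_size[OF elim(2)] by (auto simp: convergent_def)
      then have "L \<ge> 0" by (rule LIMSEQ_le_const) (simp add: norm_size_nonneg)
      moreover have "L \<noteq> 0" using L nondeg by (auto simp: degenerate_def)
      ultimately have "L > 0" by simp
      then have "\<forall>\<^sub>F n in sequentially. L / 2 < norm_size n c"
        using L by (intro order_tendstoD(1)) auto
      then have "\<forall>\<^sub>F n in sequentially. L / 2 * m ^ n \<le> gen_size c n"
        by eventually_elim (use m_pos in \<open>simp add: norm_size_def field_simps\<close>)
      with \<open>L > 0\<close> show "\<exists>a>0. \<forall>\<^sub>F n in sequentially. a * m ^ n \<le> gen_size c n"
        by (intro exI[of _ "L / 2"]) simp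
    qed
  qed
qed

section \<open>Almost sure bounds on the number of related pairs\<close>

definition total_const :: real where
  "total_const = (m / (m - 1))\<^sup>2"

lemma total_const_pos: "total_const > 0"
  using supercritical by (simp add: total_const_def)

text \<open>If \<open>envelope c\<close> is a real \<open>b\<close>, generation \<open>k\<close> has
  at most \<open>sqrt b * m ^ k\<close> vertices, and summing over \<open>k\<close> costs a factor
  \<open>m / (m - 1)\<close>. An infinite envelope makes the right side infinite.\<close>

lemma total_size_squared_le:
  "ennreal ((real (card (first_generations (ulam_harris_tree c) n)))\<^sup>2)
    \<le> ennreal (total_const * m ^ (2 * n)) * envelope c"
proof (cases "envelope c < \<infinity>")
  case False
  then have "envelope c = top" by (simp add: top.not_eq_extremum[symmetric])
  then show ?thesis using total_const_pos m_pos by (simp add: ennreal_mult_top)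
next
  case True
  define b where "b = enn2real (envelope c)"
  have b: "b \<ge> 0" "envelope c = ennreal b" using True by (simp_all add: b_def)
  have norm_le: "norm_size k c \<le> sqrt b" for k
    using norm_size_squared_le_envelope[of k c] b by (simp add: real_le_rsqrt)
  have "(real (card (first_generations (ulam_harris_tree c) n))) = (\<Sum>k\<le>n. norm_size k c * m ^ k)"
    using m_pos by (simp add: card_first_generations norm_size_def)
  also have "\<dots> \<le> (\<Sum>k\<le>n. sqrt b * m ^ k)"
    using m_pos norm_le by (intro sum_mono mult_right_mono) auto
  also have "\<dots> = sqrt b * ((m ^ Suc n - 1) / (m - 1))"
    using supercritical by (simp add: sum_distrib_left[symmetric] lessThan_Suc_atMost[symmetric]
        geometric_sum del: sum.lessThan_Suc)
  also have "\<dots> \<le> sqrt b * (m ^ Suc n / (m - 1))"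
    using supercritical b by (intro mult_left_mono divide_right_mono) auto
  finally have "(real (card (first_generations (ulam_harris_tree c) n)))\<^sup>2
      \<le> (sqrt b * (m ^ Suc n / (m - 1)))\<^sup>2"
    by (rule power_mono) simp
  also have "\<dots> = total_const * m ^ (2 * n) * b"
    using b by (simp add: total_const_def power_mult_distrib power_divide power_mult[symmetric]
        mult.commute[of n 2])
  finally show ?thesis
    using b total_const_pos m_pos by (simp add: ennreal_mult[symmetric] ennreal_leI)
qed

text \<open>Descending to the subtrees lowers \<open>k\<close> and \<open>n\<close> together and so
  preserves \<open>m ^ (2 * n) / m ^ (2 * k)\<close>. At \<open>k = 0\<close> the pairs form the
  square of the whole truncated tree.\<close>

lemma card_related_pairs_le:
  "ennreal (real (card (related_pairs c k n)))
    \<le> ennreal (total_const * m ^ (2 * n) / m ^ (2 * k)) * level_sum envelope k c"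
proof (induction k arbitrary: c n)
  case 0
  then show ?case
    using total_size_squared_le[of c n]
    by (simp add: related_pairs_0 card_cartesian_product power2_eq_square)
next
  case (Suc k)
  show ?case
  proof (cases n)
    case 0
    then show ?thesis by (simp add: related_pairs_Suc_0)
  next
    case (Suc n')
    have "ennreal (real (card (related_pairs c (Suc k) n)))
        = (\<Sum>i<c []. ennreal (real (card (related_pairs (child_offspring c i) k n'))))"
      by (simp add: Suc card_related_pairs_Suc_Suc)
    also have "\<dots> \<le> (\<Sum>i<c []. ennreal (total_const * m ^ (2 * n') / m ^ (2 * k)) *
        level_sum envelope k (child_offspring c i))"
      by (intro sum_mono Suc.IH)
    also have "\<dots> = ennreal (total_const * m ^ (2 * n') / m ^ (2 * k)) * level_sum envelope (Suc k) c"
      by (simp add: sum_distrib_left)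
    also have "total_const * m ^ (2 * n') / m ^ (2 * k) = total_const * m ^ (2 * n) / m ^ (2 * Suc k)"
      using m_pos by (simp add: Suc)
    finally show ?thesis .
  qed
qed

text \<open>The mean of \<open>level_sum envelope k\<close> is of order \<open>m ^ k\<close>, so
  after division by \<open>m ^ (2 * k)\<close> the means are summable. The resulting series is
  almost surely finite, and its terms supply \<open>s\<close>.\<close>

lemma AE_related_pairs:
  "AE c in offspring_space p. \<exists>s :: nat \<Rightarrow> real. s \<longlonglongrightarrow> 0 \<and>
     (\<forall>k n. card (related_pairs c k n) \<le> s k * m ^ (2 * n))"
proof -
  have summand: "(\<integral>\<^sup>+c. ennreal (1 / m ^ (2 * k)) * level_sum envelope k c \<partial>offspring_space p)
      = ennreal ((1 / m) ^ k) * (\<integral>\<^sup>+c. envelope c \<partial>offspring_space p)" for k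
  proof -
    have "(\<integral>\<^sup>+c. ennreal (1 / m ^ (2 * k)) * level_sum envelope k c \<partial>offspring_space p)
        = ennreal (1 / m ^ (2 * k)) * ennreal (m ^ k) * (\<integral>\<^sup>+c. envelope c \<partial>offspring_space p)"
      using m_pos by (simp add: nn_integral_cmult nn_integral_level_sum nn_integral_offspring_number
          ennreal_power mult.assoc)
    also have "ennreal (1 / m ^ (2 * k)) * ennreal (m ^ k) = ennreal (1 / m ^ (2 * k) * m ^ k)"
      using m_pos by (subst ennreal_mult'') simp_all
    also have "1 / m ^ (2 * k) * m ^ k = (1 / m) ^ k"
      using m_pos by (simp add: power_divide mult_2 power_add)
    finally show ?thesis .
  qed
  have "(\<Sum>k. ennreal ((1 / m) ^ k)) = ennreal (\<Sum>k. (1 / m) ^ k)"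
    using supercritical by (intro suminf_ennreal2 summable_geometric) auto
  then have "(\<integral>\<^sup>+c. (\<Sum>k. ennreal (1 / m ^ (2 * k)) * level_sum envelope k c) \<partial>offspring_space p) < \<infinity>"
    using nn_integral_envelope by (simp add: nn_integral_suminf summand ennreal_mult_less_top)
  then have "AE c in offspring_space p. (\<Sum>k. ennreal (1 / m ^ (2 * k)) * level_sum envelope k c) \<noteq> \<infinity>"
    by (intro nn_integral_PInf_AE) auto
  then show ?thesis
  proof eventually_elim
    case (elim c)
    \<comment> \<open>Each term of a finite series is finite, so the passage to real numbers keeps
      its value.\<close>
    define t where "t k = enn2real (ennreal (1 / m ^ (2 * k)) * level_sum envelope k c)" for k
    have t: "ennreal (t k) = ennreal (1 / m ^ (2 * k)) * level_sum envelope k c" for k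
    proof -
      have "ennreal (1 / m ^ (2 * k)) * level_sum envelope k c < top"
        by (rule ennreal_suminf_lessD) (use elim in \<open>simp add: top.not_eq_extremum\<close>)
      then show ?thesis unfolding t_def by (rule ennreal_enn2real)
    qed
    have "summable t"
      by (rule summable_suminf_not_top) (use elim in \<open>simp_all add: t, simp add: t_def\<close>)
    then have "(\<lambda>k. total_const * t k) \<longlonglongrightarrow> 0"
      by (intro tendsto_mult_right_zero summable_LIMSEQ_zero)
    moreover have "card (related_pairs c k n) \<le> total_const * t k * m ^ (2 * n)" for k n
    proof -
      have "ennreal (real (card (related_pairs c k n)))
          \<le> ennreal (total_const * m ^ (2 * n) * (1 / m ^ (2 * k))) * level_sum envelope k c"
        using card_related_pairs_le[of c k n] by simp
      also have "\<dots> = ennreal (total_const * m ^ (2 * n)) * ennreal (t k)"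
        using m_pos by (subst ennreal_mult'') (simp_all add: t mult.assoc)
      also have "\<dots> = ennreal (total_const * t k * m ^ (2 * n))"
        using m_pos total_const_pos by (simp add: ennreal_mult[symmetric] t_def mult_ac)
      finally show ?thesis
        using m_pos total_const_pos by (subst (asm) ennreal_le_iff) (simp_all add: t_def)
    qed
    ultimately show ?case by (intro exI[of _ "\<lambda>k. total_const * t k"]) auto
  qed
qed

text \<open>Neither of the two almost sure bounds involves \<open>A\<close>, so the quantifier over
  sequences can stand inside: one null set serves them all.\<close>

lemma AE_survival_property_P:
  "AE c in offspring_space p. infinite (ulam_harris_tree c) \<longrightarrow>
     (\<forall>A. (\<forall>n. generation (ulam_harris_tree c) n \<subseteq> A n \<and>
               A n \<subseteq> first_generations (ulam_harris_tree c) n)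
        \<longrightarrow> property_P (ulam_harris_tree c) A)"
  using AE_survival_growth AE_related_pairs
proof eventually_elim
  case (elim c)
  then show ?case
    using property_P_if_between[OF _ _ supercritical] by meson
qed

end

section \<open>Transfer to the given probability space\<close>

lemma (in galton_watson) distr_offspring_numbers:
  "distr M (offspring_space p) (\<lambda>\<omega> u. N u \<omega>) = offspring_space p"
proof -
  have rv: "random_variable (count_space UNIV) (N u)" for u
    using indep_offspring by (simp add: indep_vars_def)
  have "distr M (PiM UNIV (\<lambda>_. count_space UNIV)) (\<lambda>\<omega>. \<lambda>u\<in>UNIV. N u \<omega>)
      = PiM UNIV (\<lambda>u. distr M (count_space UNIV) (N u))"
    using indep_offspring
    by (subst (asm) indep_vars_iff_distr_eq_PiM) (auto simp: rv)
  also have "\<dots> = offspring_space p"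
    by (simp add: distr_offspring offspring_space_def)
  finally have *: "distr M (PiM UNIV (\<lambda>_. count_space UNIV)) (\<lambda>\<omega> u. N u \<omega>) = offspring_space p"
    by (simp add: restrict_def)
  \<comment> \<open>The two product sigma-algebras agree, as \<open>measure_pmf p\<close> measures
    every set of natural numbers.\<close>
  have "sets (offspring_space p) = sets (PiM UNIV (\<lambda>_. count_space UNIV))"
    by (subst *[symmetric]) simp
  then have "distr M (offspring_space p) (\<lambda>\<omega> u. N u \<omega>)
      = distr M (PiM UNIV (\<lambda>_. count_space UNIV)) (\<lambda>\<omega> u. N u \<omega>)"
    by (intro distr_cong) auto
  with * show ?thesis by simp
qed

lemma (in galton_watson) measurable_offspring_numbers [measurable]:
  "(\<lambda>\<omega> u. N u \<omega>) \<in> M \<rightarrow>\<^sub>M offspring_space p"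
proof -
  have "N u \<in> M \<rightarrow>\<^sub>M measure_pmf p" for u
    using indep_offspring by (simp add: indep_vars_def cong: measurable_cong_sets)
  then show ?thesis
    unfolding offspring_space_def by (intro measurable_abs_UNIV) simp
qed

theorem lemma3p5:
  fixes M :: "'w measure" and p :: "nat pmf" and N :: "nat list \<Rightarrow> 'w \<Rightarrow> nat"
  assumes "galton_watson M p N"
    and "integrable (measure_pmf p) (\<lambda>k. real k)"
    and "measure_pmf.expectation p (\<lambda>k. real k) > 1"
    and "integrable (measure_pmf p) (\<lambda>k. (real k)\<^sup>2)"
  shows "(\<forall>l :: nat \<Rightarrow> nat. (\<forall>n. l n \<le> n) \<longrightarrow>
            (AE \<omega> in conditioned_on_survival M N.
               property_P (gw_tree N \<omega>) (\<lambda>n. last_generations (gw_tree N \<omega>) (l n) n)))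
       \<and> (AE \<omega> in conditioned_on_survival M N.
            property_P (gw_tree N \<omega>) (\<lambda>n. generation (gw_tree N \<omega>) n) \<and>
            property_P (gw_tree N \<omega>) (\<lambda>n. first_generations (gw_tree N \<omega>) n))"
proof -
  interpret galton_watson M p N by fact
  interpret supercritical p "measure_pmf.expectation p real"
    by unfold_locales (use assms in simp_all)
  have "AE c in distr M (offspring_space p) (\<lambda>\<omega> u. N u \<omega>). infinite (ulam_harris_tree c) \<longrightarrow>
     (\<forall>A. (\<forall>n. generation (ulam_harris_tree c) n \<subseteq> A n \<and>
               A n \<subseteq> first_generations (ulam_harris_tree c) n)
        \<longrightarrow> property_P (ulam_harris_tree c) A)"
    unfolding distr_offspring_numbers by (rule AE_survival_property_P)
  then have ae: "AE \<omega> in M. infinite (gw_tree N \<omega>) \<longrightarrow>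
     (\<forall>A. (\<forall>n. generation (gw_tree N \<omega>) n \<subseteq> A n \<and> A n \<subseteq> first_generations (gw_tree N \<omega>) n)
        \<longrightarrow> property_P (gw_tree N \<omega>) A)"
    unfolding gw_tree_def by (rule AE_distrD[OF measurable_offspring_numbers])
  \<comment> \<open>Survival is a measurable event, so an implication that holds almost surely under
    \<open>M\<close> passes to the conditioned measure without its premise.\<close>
  have "{\<omega> \<in> space M. infinite (gw_tree N \<omega>)}
      = {\<omega> \<in> space M. \<forall>n. real (gen_size (\<lambda>u. N u \<omega>) n) > 0}"
    by (simp add: gw_tree_def infinite_tree_iff)
  also have "\<dots> \<in> sets M"
    using measurable_compose[OF measurable_offspring_numbers measurable_gen_size] by measurable
  finally have "AE \<omega> in conditioned_on_survival M N.
     (\<forall>A. (\<forall>n. generation (gw_tree N \<omega>) n \<subseteq> A n \<and> A n \<subseteq> first_generations (gw_tree N \<omega>) n)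
        \<longrightarrow> property_P (gw_tree N \<omega>) A)"
    unfolding conditioned_on_survival_def using ae by (intro AE_uniform_measureI) auto
  \<comment> \<open>The window of last generations always contains height \<open>n\<close> and never
    exceeds it, so every sequence of the theorem lies between the two extremes.\<close>
  moreover have "generation T n \<subseteq> last_generations T k n" "last_generations T k n \<subseteq> first_generations T n"
    "generation T n \<subseteq> first_generations T n" for T k n
    by (force simp: last_generations_def first_generations_def)+
  ultimately show ?thesis
    by (intro conjI allI impI; elim eventually_mono) simp_all
qed

end
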